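(* There exist finitely irreducible conformal GDMSs $\mathcal S_1,\dots,\mathcal S_5$ such that (i) $\theta_1(\mathcal S_1)<\theta_2(\mathcal S_1)$; (ii) $\theta_1(\mathcal S_2)<\theta(\mathcal S_2)$; (iii) $\theta(\mathcal S_3)<\theta_2(\mathcal S_3)$; (iv) $\theta_2(\mathcal S_4)<\theta_3(\mathcal S_4)$; (v) $\theta_2(\mathcal S_5)<\theta(\mathcal S_5)$.
   Context: $\mathbb N=\{1,2,\dots\}$ and $\dim_{\mathcal H}$ is Hausdorff dimension ($\dim_{\mathcal H}\emptyset=0$). GDMS. A graph directed Markov system (GDMS) $\mathcal S=\{\phi_e\}_{e\in E}$ consists of: a directed multigraph with a countable set of edges $E$ (the alphabet) and a finite set of vertices $V$; an incidence matrix $A:E\times E\to\{0,1\}$; functions $i,t:E\to V$ with $t(a)=i(b)$ whenever $A_{ab}=1$; nonempty compact metric spaces $X_v$, $v\in V$; a number $0<s<1$; and injective maps $\phi_e:X_{t(e)}\to X_{i(e)}$, $e\in E$, each with Lipschitz constant at most $s$. It is assumed that for every $v\in V$ there are $e,e'\in E$ with $t(e)=v$, $i(e')=v$. Words and limit sets. For $F\subset E$ and $n\ge1$ let $F_A^n=\{\omega\in F^n: A_{\omega_k\omega_{k+1}}=1,\ 1\le k\le n-1\}$, $F_A^0=\{\emptyset\}$ (the empty word), $F_A^*=\bigcup_{n\ge0}F_A^n$, $F_A^{\mathbb N}=\{\omega\in F^{\mathbb N}:A_{\omega_k\omega_{k+1}}=1\ \forall k\}$. For $\omega\in E_A^n$,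 $n\ge1$, put $\phi_\omega=\phi_{\omega_1}\circ\cdots\circ\phi_{\omega_n}$, $t(\omega)=t(\omega_n)$. For $\omega\in E_A^{\mathbb N}$, $\pi(\omega)$ is the unique point of $\bigcap_{n\ge1}\phi_{\omega_1\cdots\omega_n}(X_{t(\omega_n)})$. For $F\subset E$, $J_F=\pi(F_A^{\mathbb N})$. Conformality. The GDMS is conformal if (a) each $X_v$ is a compact connected subset of a fixed ambient space $M$ with $X_v=\overline{\mathrm{Int}(X_v)}$; (b) (open set condition) $\phi_a(\mathrm{Int}(X_{t(a)}))\cap\phi_b(\mathrm{Int}(X_{t(b)}))=\emptyset$ for $a\ne b$ in $E$; (c) for every $v\in V$ there is an open connected set $W_v\supset X_v$ such that every $\phi_e$ with $t(e)=v$ extends to a conformal diffeomorphism of $W_v$ into $W_{i(e)}$. Here $M$ is either Euclidean ($\mathbb R^n$ or $\mathbb C$), with conformal having its standard meaning and $\|Df(p)\|$ the norm of the derivative, or a Carnot group (connected, simply connected nilpotent Lie group with stratified Lie algebra generated by its first layer) with Carnot–Carathéodory metric $d$, where a homeomorphism $f$ between domains is conformal if $\lim_{r\to0}\frac{\sup\{d(f(p),f(q)):d(p,q)=r\}}{\inf\{d(f(p),f(q)):d(p,q)=r\}}=1$ for all $p$, and $\|Df(p)\|=\lim_{q\to p}\frac{d(f(p),f(q))}{d(p,q)}$. Fix pairwise disjoint compact sets $S_v$ with $X_v\subset\mathrm{Int}(S_v)\subset S_v\subset W_v$ and put $\|D\phi_\omega\|_\infty=\sup_{p\in S_{t(\omega)}}\|D\phi_\omega(p)\|$.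 Pressure. For $t\ge0$, $P(t)=\lim_{n\to\infty}\frac1n\log\sum_{\omega\in E_A^n}\|D\phi_\omega\|_\infty^t$ (the limit exists in $[-\infty,+\infty]$). Irreducibility. For $F\subset E$, $F$ is irreducible if there is $\Lambda\subset F_A^*$ such that for all $i,j\in F$ there is $\omega\in\Lambda$ with $i\omega j\in F_A^*$; $F$ is finitely irreducible if $\Lambda$ can be chosen finite. $\mathcal S$ is finitely irreducible if $E$ is. Parameters. $\theta(\mathcal S)=\inf\{t\ge0:P(t)<+\infty\}$; $\theta_1(\mathcal S)=\inf\{\dim_{\mathcal H}(J_F):F\subset E\text{ cofinite}\}$; $\theta_2(\mathcal S)=\inf\{\dim_{\mathcal H}(J_F):F\subset E\text{ cofinite and irreducible}\}$; $\theta_3(\mathcal S)=\inf\{\dim_{\mathcal H}(J_F):F\subset E\text{ cofinite and finitely irreducible}\}$. *)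

theory Defs
  imports "HOL-Analysis.Analysis" "HOL-Algebra.Group"
begin

section \<open>A space containing every Euclidean space\<close>

text \<open>
  The existential statement ranges over ambient spaces of arbitrary finite dimension, and types
  cannot be quantified. The type below consists of the finitely supported real sequences with
  the standard inner product. Its finite-dimensional subspaces are, up to linear isometry, exactly
  the spaces \<open>\<real>\<^sup>n\<close>.
\<close>

typedef finseq = "{f :: nat \<Rightarrow> real. finite {i. f i \<noteq> 0}}"
  morphisms coord Abs_finseq
  by (rule exI[of _ "\<lambda>_. 0"]) simp

setup_lifting type_definition_finseq

lemma finseq_eqI: "(\<And>i. coord x i = coord y i) \<Longrightarrow> x = y"
  by (metis coord_inject ext)

lemma finite_support_coord [simp]: "finite {i. coord x i \<noteq> 0}"
  using coord by blast

instantiation finseq :: real_vector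
begin

lift_definition zero_finseq :: finseq is "\<lambda>_. 0" by simp

lift_definition plus_finseq :: "finseq \<Rightarrow> finseq \<Rightarrow> finseq" is "\<lambda>f g i. f i + g i"
proof -
  fix f g :: "nat \<Rightarrow> real"
  assume "finite {i. f i \<noteq> 0}" "finite {i. g i \<noteq> 0}"
  then have "finite ({i. f i \<noteq> 0} \<union> {i. g i \<noteq> 0})"
    by simp
  then show "finite {i. f i + g i \<noteq> 0}"
    by (rule rev_finite_subset) auto
qed

lift_definition uminus_finseq :: "finseq \<Rightarrow> finseq" is "\<lambda>f i. - f i" by simp

lift_definition minus_finseq :: "finseq \<Rightarrow> finseq \<Rightarrow> finseq" is "\<lambda>f g i. f i - g i"
proof -
  fix f g :: "nat \<Rightarrow> real"
  assume "finite {i. f i \<noteq> 0}" "finite {i. g i \<noteq> 0}"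
  then have "finite ({i. f i \<noteq> 0} \<union> {i. g i \<noteq> 0})"
    by simp
  then show "finite {i. f i - g i \<noteq> 0}"
    by (rule rev_finite_subset) auto
qed

lift_definition scaleR_finseq :: "real \<Rightarrow> finseq \<Rightarrow> finseq" is "\<lambda>c f i. c * f i"
  by (rule finite_subset) auto

instance
  by standard (transfer; auto simp: algebra_simps)+

end

lemma coord_simps [simp]:
  "coord 0 i = 0" "coord (x + y) i = coord x i + coord y i" "coord (- x) i = - coord x i"
  "coord (x - y) i = coord x i - coord y i" "coord (c *\<^sub>R x) i = c * coord x i"
  by (transfer, simp)+

instantiation finseq :: real_inner
begin

definition inner_finseq :: "finseq \<Rightarrow> finseq \<Rightarrow> real"
  where "inner_finseq x y = (\<Sum>i | coord x i \<noteq> 0. coord x i * coord y i)"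

definition norm_finseq :: "finseq \<Rightarrow> real"
  where "norm_finseq x = sqrt (inner x x)"

definition sgn_finseq :: "finseq \<Rightarrow> finseq"
  where "sgn_finseq x = x /\<^sub>R norm x"

definition dist_finseq :: "finseq \<Rightarrow> finseq \<Rightarrow> real"
  where "dist_finseq x y = norm (x - y)"

definition uniformity_finseq :: "(finseq \<times> finseq) filter"
  where "uniformity_finseq = (INF e\<in>{0<..}. principal {(x, y). dist x y < e})"

definition open_finseq :: "finseq set \<Rightarrow> bool"
  where "open_finseq U \<longleftrightarrow> (\<forall>x\<in>U. \<forall>\<^sub>F (x', y) in uniformity. x' = x \<longrightarrow> y \<in> U)"

lemma inner_finseq_eq:
  assumes "finite I" "{i. coord x i \<noteq> 0} \<subseteq> I \<or> {i. coord y i \<noteq> 0} \<subseteq> I"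
  shows "inner x y = (\<Sum>i\<in>I. coord x i * coord y i)"
proof -
  have "inner x y = (\<Sum>i\<in>{i. coord x i \<noteq> 0} \<union> I. coord x i * coord y i)"
    unfolding inner_finseq_def
    by (rule sum.mono_neutral_left) (use assms(1) in auto)
  also have "\<dots> = (\<Sum>i\<in>I. coord x i * coord y i)"
    by (rule sum.mono_neutral_right) (use assms in auto)
  finally show ?thesis .
qed

instance
proof
  fix x y z :: finseq and r :: real
  let ?I = "{i. coord x i \<noteq> 0} \<union> {i. coord y i \<noteq> 0}"
  have I: "finite ?I" by simp
  show "inner x y = inner y x"
    by (simp add: inner_finseq_eq[OF I] mult.commute)
  show "inner (x + y) z = inner x z + inner y z"
  proof -
    have "{i. coord (x + y) i \<noteq> 0} \<subseteq> ?I" by auto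
    thus ?thesis
      by (simp add: inner_finseq_eq[OF I] distrib_right sum.distrib)
  qed
  show "inner (r *\<^sub>R x) y = r * inner x y"
  proof -
    have "{i. coord (r *\<^sub>R x) i \<noteq> 0} \<subseteq> ?I" by auto
    thus ?thesis
      by (simp add: inner_finseq_eq[OF I] sum_distrib_left mult.assoc)
  qed
  show "0 \<le> inner x x"
    by (simp add: inner_finseq_def sum_nonneg)
  show "(inner x x = 0) = (x = 0)"
    by (auto simp: inner_finseq_def sum_nonneg_eq_0_iff intro!: finseq_eqI)
qed (simp_all add: norm_finseq_def sgn_finseq_def dist_finseq_def uniformity_finseq_def
       open_finseq_def)

end


section \<open>Hausdorff dimension in a metric space\<close>

definition set_diam :: "'p metric \<Rightarrow> 'p set \<Rightarrow> real"
  where "set_diam M U = (if U = {} then 0 else (SUP (x, y)\<in>U \<times> U. mdist M x y))"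

text \<open>\<open>diam(U)\<^sup>s\<close> with the usual conventions \<open>0\<^sup>0 = 1\<close> for nonempty \<open>U\<close> and \<open>0\<close> for the empty set
  (whereas \<open>0 powr 0 = 0\<close>).\<close>

definition diam_pow :: "'p metric \<Rightarrow> real \<Rightarrow> 'p set \<Rightarrow> ennreal"
  where "diam_pow M s U =
    (if U = {} then 0 else if s = 0 then 1 else ennreal (set_diam M U powr s))"

definition hausdorff_content :: "'p metric \<Rightarrow> real \<Rightarrow> real \<Rightarrow> 'p set \<Rightarrow> ennreal"
  where "hausdorff_content M s \<delta> A =
    (INF U \<in> {U :: nat \<Rightarrow> 'p set. A \<subseteq> (\<Union>k. U k) \<and>
        (\<forall>k. U k \<subseteq> mspace M \<and> (\<forall>x\<in>U k. \<forall>y\<in>U k. mdist M x y \<le> \<delta>))}.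
      \<Sum>k. diam_pow M s (U k))"

definition hausdorff_measure :: "'p metric \<Rightarrow> real \<Rightarrow> 'p set \<Rightarrow> ennreal"
  where "hausdorff_measure M s A = (SUP \<delta>\<in>{0<..}. hausdorff_content M s \<delta> A)"

definition hausdorff_dim :: "'p metric \<Rightarrow> 'p set \<Rightarrow> ereal"
  where "hausdorff_dim M A = (INF s\<in>{s. 0 \<le> s \<and> hausdorff_measure M s A = 0}. ereal s)"


section \<open>Euclidean ambient spaces\<close>

definition euclidean_ambient :: "'p::real_inner metric \<Rightarrow> bool"
  where "euclidean_ambient M \<longleftrightarrow>
    (\<exists>B. finite B \<and> mspace M = span B) \<and> mspace M \<noteq> {0} \<and>
    (\<forall>x\<in>mspace M. \<forall>y\<in>mspace M. mdist M x y = dist x y)"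

text \<open>Conformal diffeomorphisms of an open set \<open>U\<close> onto its image: injective \<open>C\<^sup>1\<close> maps whose
  derivative at each point is a similarity. A derivative within the subspace \<open>mspace M\<close> is
  determined only on \<open>mspace M\<close>, so only its values there are used.\<close>

definition euclidean_conformal ::
    "'p::real_inner metric \<Rightarrow> 'p set \<Rightarrow> ('p \<Rightarrow> 'p) \<Rightarrow> bool"
  where "euclidean_conformal M U f \<longleftrightarrow>
    inj_on f U \<and> f ` U \<subseteq> mspace M \<and>
    (\<exists>D. (\<forall>p\<in>U. (f has_derivative D p) (at p within mspace M)) \<and>
         (\<forall>p\<in>U. \<exists>c>0. \<forall>v\<in>mspace M. norm (D p v) = c * norm v) \<and>
         (\<forall>v\<in>mspace M. continuous_on U (\<lambda>p. D p v)))"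

definition euclidean_deriv_norm :: "'p::real_inner metric \<Rightarrow> ('p \<Rightarrow> 'p) \<Rightarrow> 'p \<Rightarrow> real"
  where "euclidean_deriv_norm M f p =
    (SUP v\<in>{v \<in> mspace M. norm v = 1}. norm (frechet_derivative f (at p within mspace M) v))"


section \<open>Carnot groups\<close>

text \<open>\<open>C\<^sup>k\<close> functions on a linear subspace \<open>M\<close>, where \<open>D p v\<close> is the derivative at \<open>p\<close> in
  direction \<open>v\<close>.\<close>

primrec Ck_on ::
    "nat \<Rightarrow> 'a::real_normed_vector set \<Rightarrow> ('a \<Rightarrow> 'b::real_normed_vector) \<Rightarrow> bool"
where
  "Ck_on 0 M f \<longleftrightarrow> continuous_on M f"
| "Ck_on (Suc k) M f \<longleftrightarrow>
    (\<exists>D. (\<forall>p\<in>M. (f has_derivative D p) (at p within M)) \<and> (\<forall>v\<in>M. Ck_on k M (\<lambda>p. D p v)))"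

definition smooth_on :: "'a::real_normed_vector set \<Rightarrow> ('a \<Rightarrow> 'b::real_normed_vector) \<Rightarrow> bool"
  where "smooth_on M f \<longleftrightarrow> (\<forall>k. Ck_on k M f)"

text \<open>Lie groups whose underlying manifold is a finite-dimensional vector space. Every connected,
  simply connected nilpotent Lie group is of this form, the exponential map being a global
  diffeomorphism. The tangent spaces are identified with the carrier.\<close>

definition lie_group :: "'p::real_inner monoid \<Rightarrow> bool"
  where "lie_group G \<longleftrightarrow>
    group G \<and> (\<exists>B. finite B \<and> carrier G = span B) \<and>
    smooth_on (carrier G \<times> carrier G) (\<lambda>(p, q). mult G p q) \<and>
    smooth_on (carrier G) (m_inv G)"

text \<open>The value at \<open>p\<close> of the left-invariant vector field equal to \<open>X\<close> at the identity.\<close>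

definition left_inv_field :: "'p::real_inner monoid \<Rightarrow> 'p \<Rightarrow> 'p \<Rightarrow> 'p"
  where "left_inv_field G X p =
    frechet_derivative (\<lambda>q. mult G p q) (at (one G) within carrier G) X"

definition lie_bracket :: "'p::real_inner monoid \<Rightarrow> 'p \<Rightarrow> 'p \<Rightarrow> 'p"
  where "lie_bracket G X Y =
    frechet_derivative (left_inv_field G Y) (at (one G) within carrier G) X -
    frechet_derivative (left_inv_field G X) (at (one G) within carrier G) Y"

text \<open>\<open>L 1, L 2, \<dots>\<close> are the layers of the stratification. Nilpotency of the Lie algebra is a
  consequence.\<close>

definition stratification :: "'p::real_inner monoid \<Rightarrow> (nat \<Rightarrow> 'p set) \<Rightarrow> bool"
  where "stratification G L \<longleftrightarrow>
    (\<exists>k\<ge>1. (\<forall>i\<in>{1..k}. L i \<noteq> {0}) \<and> (\<forall>i>k. L i = {0}) \<and>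
      (\<forall>i\<ge>1. subspace (L i) \<and> L i \<subseteq> carrier G) \<and>
      (\<forall>x\<in>carrier G. \<exists>!v. (\<forall>i\<in>{1..k}. v i \<in> L i) \<and> (\<forall>i. i \<notin> {1..k} \<longrightarrow> v i = 0) \<and>
         x = (\<Sum>i=1..k. v i)) \<and>
      (\<forall>i\<ge>1. span {lie_bracket G X Y |X Y. X \<in> L 1 \<and> Y \<in> L i} = L (Suc i)))"

text \<open>Lengths of the horizontal curves from \<open>x\<close> to \<open>y\<close> for the left-invariant sub-Riemannian
  structure given on the first layer \<open>H\<close> by the ambient inner product. A linear change of
  coordinates turns an arbitrary inner product on \<open>H\<close> into this one.\<close>

definition horizontal_lengths :: "'p::real_inner monoid \<Rightarrow> 'p set \<Rightarrow> 'p \<Rightarrow> 'p \<Rightarrow> real set"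
  where "horizontal_lengths G H x y =
    {l. \<exists>\<gamma> u N. \<gamma> piecewise_C1_differentiable_on {0..1} \<and> \<gamma> ` {0..1} \<subseteq> carrier G \<and>
       \<gamma> 0 = x \<and> \<gamma> 1 = y \<and> finite N \<and>
       (\<forall>\<tau>\<in>{0<..<1} - N. u \<tau> \<in> H \<and>
          (\<gamma> has_vector_derivative left_inv_field G (u \<tau>) (\<gamma> \<tau>)) (at \<tau>)) \<and>
       ((\<lambda>\<tau>. norm (u \<tau>)) has_integral l) {0..1}}"

text \<open>Carnot groups with their Carnot-Caratheodory metric.\<close>

definition carnot_ambient :: "'p::real_inner metric \<Rightarrow> bool"
  where "carnot_ambient M \<longleftrightarrow>
    (\<exists>G L. lie_group G \<and> stratification G L \<and> mspace M = carrier G \<and>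
       (\<forall>x\<in>mspace M. \<forall>y\<in>mspace M. mdist M x y = Inf (horizontal_lengths G (L 1) x y)))"

definition metric_deriv_norm :: "'p metric \<Rightarrow> ('p \<Rightarrow> 'p) \<Rightarrow> 'p \<Rightarrow> real"
  where "metric_deriv_norm M f p =
    Lim (atin (mtopology_of M) p) (\<lambda>q. mdist M (f p) (f q) / mdist M p q)"

text \<open>Metrically conformal homeomorphisms. That \<open>D p\<close>, the norm of the derivative, exists, is
  positive and depends continuously on \<open>p\<close> spells out ``diffeomorphism''. It is automatic
  except in topological dimension one.\<close>

definition metric_conformal :: "'p metric \<Rightarrow> 'p set \<Rightarrow> ('p \<Rightarrow> 'p) \<Rightarrow> bool"
  where "metric_conformal M U f \<longleftrightarrow>
    openin (mtopology_of M) (f ` U) \<and>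
    homeomorphic_map (subtopology (mtopology_of M) U) (subtopology (mtopology_of M) (f ` U)) f \<and>
    (\<forall>p\<in>U. ((\<lambda>r. (SUP q\<in>{q \<in> U. mdist M p q = r}. mdist M (f p) (f q)) /
                 (INF q\<in>{q \<in> U. mdist M p q = r}. mdist M (f p) (f q))) \<longlongrightarrow> 1) (at_right 0)) \<and>
    (\<exists>D. continuous_map (subtopology (mtopology_of M) U) euclideanreal D \<and>
       (\<forall>p\<in>U. 0 < D p \<and>
          ((\<lambda>q. mdist M (f p) (f q) / mdist M p q) \<longlongrightarrow> D p) (atin (mtopology_of M) p)))"


section \<open>Ambient spaces\<close>

datatype 'p ambient = Euclidean "'p metric" | Carnot "'p metric"

fun amb_metric :: "'p ambient \<Rightarrow> 'p metric" where
  "amb_metric (Euclidean M) = M"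
| "amb_metric (Carnot M) = M"

fun ambient_space :: "'p::real_inner ambient \<Rightarrow> bool" where
  "ambient_space (Euclidean M) \<longleftrightarrow> euclidean_ambient M"
| "ambient_space (Carnot M) \<longleftrightarrow> carnot_ambient M"

fun conformal_on :: "'p::real_inner ambient \<Rightarrow> 'p set \<Rightarrow> ('p \<Rightarrow> 'p) \<Rightarrow> bool" where
  "conformal_on (Euclidean M) U f \<longleftrightarrow> euclidean_conformal M U f"
| "conformal_on (Carnot M) U f \<longleftrightarrow> metric_conformal M U f"

fun deriv_norm :: "'p::real_inner ambient \<Rightarrow> ('p \<Rightarrow> 'p) \<Rightarrow> 'p \<Rightarrow> real" where
  "deriv_norm (Euclidean M) f p = euclidean_deriv_norm M f p"
| "deriv_norm (Carnot M) f p = metric_deriv_norm M f p"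


section \<open>Conformal graph directed Markov systems\<close>

text \<open>The function \<open>phi e\<close> is the contraction of the system on \<open>Xset (ter e)\<close> and its conformal
  extension on \<open>Wset (ter e)\<close>; its values elsewhere are irrelevant. The sets \<open>Sset v\<close> are those over
  which the norms of derivatives are maximised.\<close>

record ('e, 'v, 'p) gdms =
  edges :: "'e set"
  verts :: "'v set"
  inc :: "'e \<Rightarrow> 'e \<Rightarrow> bool"
  ini :: "'e \<Rightarrow> 'v"
  ter :: "'e \<Rightarrow> 'v"
  amb :: "'p ambient"
  Xset :: "'v \<Rightarrow> 'p set"
  Wset :: "'v \<Rightarrow> 'p set"
  Sset :: "'v \<Rightarrow> 'p set"
  phi :: "'e \<Rightarrow> 'p \<Rightarrow> 'p"

abbreviation amb_top :: "('e, 'v, 'p) gdms \<Rightarrow> 'p topology"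
  where "amb_top Sys \<equiv> mtopology_of (amb_metric (amb Sys))"

definition is_gdms :: "('e, 'v, 'p) gdms \<Rightarrow> bool"
  where "is_gdms Sys \<longleftrightarrow>
    countable (edges Sys) \<and> finite (verts Sys) \<and>
    (\<forall>e\<in>edges Sys. ini Sys e \<in> verts Sys \<and> ter Sys e \<in> verts Sys) \<and>
    (\<forall>a\<in>edges Sys. \<forall>b\<in>edges Sys. inc Sys a b \<longrightarrow> ter Sys a = ini Sys b) \<and>
    (\<forall>v\<in>verts Sys. Xset Sys v \<noteq> {} \<and> compactin (amb_top Sys) (Xset Sys v)) \<and>
    (\<exists>s. 0 < s \<and> s < 1 \<and>
       (\<forall>e\<in>edges Sys. phi Sys e ` Xset Sys (ter Sys e) \<subseteq> Xset Sys (ini Sys e) \<and>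
          inj_on (phi Sys e) (Xset Sys (ter Sys e)) \<and>
          (\<forall>x\<in>Xset Sys (ter Sys e). \<forall>y\<in>Xset Sys (ter Sys e).
             mdist (amb_metric (amb Sys)) (phi Sys e x) (phi Sys e y)
               \<le> s * mdist (amb_metric (amb Sys)) x y))) \<and>
    (\<forall>v\<in>verts Sys. \<exists>e\<in>edges Sys. \<exists>e'\<in>edges Sys. ter Sys e = v \<and> ini Sys e' = v)"

definition conformal_gdms :: "('e, 'v, 'p::real_inner) gdms \<Rightarrow> bool"
  where "conformal_gdms Sys \<longleftrightarrow>
    is_gdms Sys \<and> ambient_space (amb Sys) \<and>
    (\<forall>v\<in>verts Sys. connectedin (amb_top Sys) (Xset Sys v) \<and>
       Xset Sys v = amb_top Sys closure_of (amb_top Sys interior_of Xset Sys v)) \<and>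
    (\<forall>a\<in>edges Sys. \<forall>b\<in>edges Sys. a \<noteq> b \<longrightarrow>
       phi Sys a ` (amb_top Sys interior_of Xset Sys (ter Sys a)) \<inter>
       phi Sys b ` (amb_top Sys interior_of Xset Sys (ter Sys b)) = {}) \<and>
    (\<forall>v\<in>verts Sys. openin (amb_top Sys) (Wset Sys v) \<and> connectedin (amb_top Sys) (Wset Sys v) \<and>
       Xset Sys v \<subseteq> Wset Sys v) \<and>
    (\<forall>e\<in>edges Sys. conformal_on (amb Sys) (Wset Sys (ter Sys e)) (phi Sys e) \<and>
       phi Sys e ` Wset Sys (ter Sys e) \<subseteq> Wset Sys (ini Sys e)) \<and>
    (\<forall>v\<in>verts Sys. compactin (amb_top Sys) (Sset Sys v) \<and>
       Xset Sys v \<subseteq> amb_top Sys interior_of Sset Sys v \<and> Sset Sys v \<subseteq> Wset Sys v) \<and>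
    (\<forall>v\<in>verts Sys. \<forall>w\<in>verts Sys. v \<noteq> w \<longrightarrow> Sset Sys v \<inter> Sset Sys w = {})"

definition words :: "('e, 'v, 'p) gdms \<Rightarrow> 'e set \<Rightarrow> nat \<Rightarrow> 'e list set"
  where "words Sys F n = {w. length w = n \<and> set w \<subseteq> F \<and> successively (inc Sys) w}"

definition fin_words :: "('e, 'v, 'p) gdms \<Rightarrow> 'e set \<Rightarrow> 'e list set"
  where "fin_words Sys F = (\<Union>n. words Sys F n)"

definition inf_words :: "('e, 'v, 'p) gdms \<Rightarrow> 'e set \<Rightarrow> (nat \<Rightarrow> 'e) set"
  where "inf_words Sys F = {\<omega>. range \<omega> \<subseteq> F \<and> (\<forall>k. inc Sys (\<omega> k) (\<omega> (Suc k)))}"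

definition word_map :: "('e, 'v, 'p) gdms \<Rightarrow> 'e list \<Rightarrow> 'p \<Rightarrow> 'p"
  where "word_map Sys w = foldr (\<lambda>e f. phi Sys e \<circ> f) w id"

text \<open>Infinite words are indexed from \<open>0\<close>, so the last letter of the prefix of length \<open>n\<close>
  is \<open>\<omega> (n - 1)\<close>.\<close>

definition coding :: "('e, 'v, 'p) gdms \<Rightarrow> (nat \<Rightarrow> 'e) \<Rightarrow> 'p"
  where "coding Sys \<omega> =
    the_elem (\<Inter>n\<in>{1..}. word_map Sys (map \<omega> [0..<n]) ` Xset Sys (ter Sys (\<omega> (n - 1))))"

definition limit_set :: "('e, 'v, 'p) gdms \<Rightarrow> 'e set \<Rightarrow> 'p set"
  where "limit_set Sys F = coding Sys ` inf_words Sys F"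

definition limit_dim :: "('e, 'v, 'p) gdms \<Rightarrow> 'e set \<Rightarrow> ereal"
  where "limit_dim Sys F = hausdorff_dim (amb_metric (amb Sys)) (limit_set Sys F)"

definition word_norm :: "('e, 'v, 'p::real_inner) gdms \<Rightarrow> 'e list \<Rightarrow> real"
  where "word_norm Sys w =
    (SUP p\<in>Sset Sys (ter Sys (last w)). deriv_norm (amb Sys) (word_map Sys w) p)"

definition log_ennreal :: "ennreal \<Rightarrow> ereal"
  where "log_ennreal z =
    (if z = 0 then - \<infinity> else if z = \<infinity> then \<infinity> else ereal (ln (enn2real z)))"

definition pressure :: "('e, 'v, 'p::real_inner) gdms \<Rightarrow> real \<Rightarrow> ereal"
  where "pressure Sys \<tau> =
    lim (\<lambda>n. log_ennreal (\<Sum>\<^sub>\<infinity>w\<in>words Sys (edges Sys) n. ennreal (word_norm Sys w powr \<tau>))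
               / ereal (real n))"

definition irreducible_alphabet :: "('e, 'v, 'p) gdms \<Rightarrow> 'e set \<Rightarrow> bool"
  where "irreducible_alphabet Sys F \<longleftrightarrow>
    (\<exists>\<Lambda> \<subseteq> fin_words Sys F. \<forall>i\<in>F. \<forall>j\<in>F. \<exists>w\<in>\<Lambda>. [i] @ w @ [j] \<in> fin_words Sys F)"

definition finitely_irreducible_alphabet :: "('e, 'v, 'p) gdms \<Rightarrow> 'e set \<Rightarrow> bool"
  where "finitely_irreducible_alphabet Sys F \<longleftrightarrow>
    (\<exists>\<Lambda> \<subseteq> fin_words Sys F. finite \<Lambda> \<and>
       (\<forall>i\<in>F. \<forall>j\<in>F. \<exists>w\<in>\<Lambda>. [i] @ w @ [j] \<in> fin_words Sys F))"

definition cofinite_subsets :: "('e, 'v, 'p) gdms \<Rightarrow> 'e set set"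
  where "cofinite_subsets Sys = {F. F \<subseteq> edges Sys \<and> finite (edges Sys - F)}"

definition theta :: "('e, 'v, 'p::real_inner) gdms \<Rightarrow> ereal"
  where "theta Sys = (INF \<tau>\<in>{\<tau>. 0 \<le> \<tau> \<and> pressure Sys \<tau> < \<infinity>}. ereal \<tau>)"

definition theta1 :: "('e, 'v, 'p) gdms \<Rightarrow> ereal"
  where "theta1 Sys = (INF F\<in>cofinite_subsets Sys. limit_dim Sys F)"

definition theta2 :: "('e, 'v, 'p) gdms \<Rightarrow> ereal"
  where "theta2 Sys = (INF F\<in>{F \<in> cofinite_subsets Sys. irreducible_alphabet Sys F}. limit_dim Sys F)"

definition theta3 :: "('e, 'v, 'p) gdms \<Rightarrow> ereal"
  where "theta3 Sys =
    (INF F\<in>{F \<in> cofinite_subsets Sys. finitely_irreducible_alphabet Sys F}. limit_dim Sys F)"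

end

theory Submission
  imports Defs
begin

text \<open>
  All systems are one-dimensional, with a single vertex, affine generators and alphabet \<open>\<nat>\<close>. The letters
  \<open>0\<close> and \<open>1\<close> have ratio \<open>1/4\<close> and can follow each other freely, which produces a Cantor set of dimension
  \<open>1/2\<close>. The other letters, the rungs, are always followed by \<open>0\<close> or by a rung prescribed by a relation
  \<open>K\<close>, and only \<open>1\<close> and rungs lead to a rung, so leaving the rungs and coming back uses both \<open>0\<close> and \<open>1\<close>.
  If \<open>K\<close> only relates neighbouring rungs, each rung has at most two rungs as successors, and since their
  ratios are at most \<open>1/16\<close> the rungs alone have a limit set of dimension at most \<open>1/3\<close>.

  In the star, \<open>K\<close> is empty: an irreducible cofinite alphabet contains \<open>0\<close> and \<open>1\<close>, so \<open>\<theta>\<^sub>2 \<ge> 1/2\<close>,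
  whereas \<open>\<theta>\<^sub>1 \<le> 1/3\<close>, and geometric ratios give \<open>\<theta> \<le> 1/4\<close>. In the rail, \<open>K\<close> relates all neighbours:
  the rungs are irreducible, so \<open>\<theta>\<^sub>2 \<le> 1/3\<close>, but connecting distant rungs by words of bounded length
  requires \<open>0\<close> and \<open>1\<close>, so \<open>\<theta>\<^sub>3 \<ge> 1/2\<close>, and ratios of order \<open>k\<^sup>-\<^sup>2\<close> give \<open>\<theta> \<ge> 1/2\<close>.
\<close>


section \<open>Estimates of the Hausdorff dimension\<close>

text \<open>Each \<open>A m\<close> gets a cover whose sum exceeds its content by at most
  \<open>e * (1/2) ^ Suc m\<close>. A pairing of the indices merges these covers into one sequence,
  and the excesses add up to \<open>e\<close>.\<close>

lemma hausdorff_content_UN_le: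
  fixes A :: "nat \<Rightarrow> 'p set"
  shows "hausdorff_content M s \<delta> (\<Union>m. A m) \<le> (\<Sum>m. hausdorff_content M s \<delta> (A m))"
proof (rule ennreal_le_epsilon)
  fix e :: real
  assume fin: "(\<Sum>m. hausdorff_content M s \<delta> (A m)) < Orderings.top" and e: "0 < e"
  let ?C = "\<lambda>A. {U :: nat \<Rightarrow> 'p set. A \<subseteq> (\<Union>k. U k) \<and>
        (\<forall>k. U k \<subseteq> mspace M \<and> (\<forall>x\<in>U k. \<forall>y\<in>U k. mdist M x y \<le> \<delta>))}"
  have "\<exists>U\<in>?C (A m). (\<Sum>k. diam_pow M s (U k)) \<le>
      hausdorff_content M s \<delta> (A m) + ennreal (e * (1/2) ^ Suc m)" for m
  proof -
    \<comment> \<open>A cover close to the infimum comes from a strict inequality, which requires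
      the content of \<open>A m\<close> to be finite.\<close>
    have "hausdorff_content M s \<delta> (A m) < Orderings.top"
      using ennreal_suminf_lessD[OF fin] .
    then obtain c where "0 \<le> c" and c: "hausdorff_content M s \<delta> (A m) = ennreal c"
      by (cases "hausdorff_content M s \<delta> (A m)") auto
    moreover have "0 < e * (1/2) ^ Suc m"
      using e by simp
    ultimately have "hausdorff_content M s \<delta> (A m) <
        hausdorff_content M s \<delta> (A m) + ennreal (e * (1/2) ^ Suc m)"
      unfolding c by (subst ennreal_plus[symmetric]) (auto intro: ennreal_lessI)
    then show ?thesis
      unfolding hausdorff_content_def[of M s \<delta> "A m"] INF_less_iff
      by (blast intro: less_imp_le)
  qed
  then have "\<forall>m. \<exists>U. U \<in> ?C (A m) \<and> (\<Sum>k. diam_pow M s (U k)) \<le>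
      hausdorff_content M s \<delta> (A m) + ennreal (e * (1/2) ^ Suc m)"
    unfolding Bex_def by (rule allI)
  from choice[OF this] obtain U where U: "\<And>m. U m \<in> ?C (A m)"
    and le: "\<And>m. (\<Sum>k. diam_pow M s (U m k)) \<le>
      hausdorff_content M s \<delta> (A m) + ennreal (e * (1/2) ^ Suc m)"
    by blast
  define V where "V = (\<lambda>(m, k). U m k) \<circ> prod_decode"
  have "(\<Union>m. A m) \<subseteq> (\<Union>k. V k)"
  proof
    fix x assume "x \<in> (\<Union>m. A m)"
    then obtain m k where "x \<in> U m k"
      using U by blast
    then have "x \<in> V (prod_encode (m, k))"
      by (simp add: V_def)
    then show "x \<in> (\<Union>k. V k)" by blast
  qed
  moreover have "V k \<subseteq> mspace M \<and> (\<forall>x\<in>V k. \<forall>y\<in>V k. mdist M x y \<le> \<delta>)" for k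
    using U by (auto simp: V_def split: prod.split)
  ultimately have "V \<in> ?C (\<Union>m. A m)"
    by blast
  then have "hausdorff_content M s \<delta> (\<Union>m. A m) \<le> (\<Sum>k. diam_pow M s (V k))"
    unfolding hausdorff_content_def by (rule INF_lower)
  also have "\<dots> = (\<Sum>m. \<Sum>k. diam_pow M s (U m k))"
    using suminf_ennreal_2dimen[of "\<lambda>m. \<Sum>k. diam_pow M s (U m k)" "\<lambda>(m, k). diam_pow M s (U m k)"]
    by (simp add: V_def case_prod_unfold comp_def)
  also have "\<dots> \<le> (\<Sum>m. hausdorff_content M s \<delta> (A m) + ennreal (e * (1/2) ^ Suc m))"
    by (rule suminf_le) (use le in auto)
  also have "\<dots> = (\<Sum>m. hausdorff_content M s \<delta> (A m)) + (\<Sum>m. ennreal (e * (1/2) ^ Suc m))"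
    by (rule suminf_add[symmetric]) auto
  also have "(\<Sum>m. ennreal (e * (1/2) ^ Suc m)) = ennreal e"
    using e sums_mult[OF power_half_series, of e]
    by (intro suminf_ennreal_eq) auto
  finally show "hausdorff_content M s \<delta> (\<Union>m. A m) \<le> (\<Sum>m. hausdorff_content M s \<delta> (A m)) + ennreal e" .
qed

text \<open>Padding with empty sets, which cost nothing under \<open>diam_pow\<close>, turns the
  finite cover into the sequence that the definition of the content asks for.\<close>

lemma hausdorff_content_finite_cover:
  assumes "finite I" "A \<subseteq> (\<Union>i\<in>I. U i)" "\<And>i. i \<in> I \<Longrightarrow> U i \<subseteq> mspace M"
    and d: "\<And>i x y. i \<in> I \<Longrightarrow> x \<in> U i \<Longrightarrow> y \<in> U i \<Longrightarrow> mdist M x y \<le> d"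
    and "0 \<le> d" "d \<le> \<delta>" "0 < s"
  shows "hausdorff_content M s \<delta> A \<le> ennreal (card I * d powr s)"
proof -
  obtain f where f: "bij_betw f {0..<card I} I"
    using ex_bij_betw_nat_finite[OF assms(1)] by blast
  define V where "V k = (if k < card I then U (f k) else {})" for k
  have fI: "f k \<in> I" if "k < card I" for k
    using f that by (auto simp: bij_betw_def)
  have "A \<subseteq> (\<Union>k. V k)"
  proof
    fix x assume "x \<in> A"
    then obtain i where "i \<in> I" "x \<in> U i" using assms(2) by blast
    moreover obtain k where "k < card I" "f k = i"
      using f \<open>i \<in> I\<close> by (metis atLeastLessThan_iff bij_betw_iff_bijections)
    ultimately have "x \<in> V k" by (simp add: V_def)
    then show "x \<in> (\<Union>k. V k)" by blast
  qed
  moreover have "V k \<subseteq> mspace M" for k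
    using assms(3) fI by (simp add: V_def)
  moreover have "\<forall>x\<in>V k. \<forall>y\<in>V k. mdist M x y \<le> \<delta>" for k
    using d[OF fI] \<open>d \<le> \<delta>\<close> by (auto simp: V_def intro: order_trans)
  ultimately have "hausdorff_content M s \<delta> A \<le> (\<Sum>k. diam_pow M s (V k))"
    unfolding hausdorff_content_def by (intro INF_lower) blast
  also have "\<dots> = (\<Sum>k<card I. diam_pow M s (V k))"
    by (rule suminf_finite) (auto simp: V_def diam_pow_def)
  also have "\<dots> \<le> (\<Sum>k<card I. ennreal (d powr s))"
  proof (rule sum_mono)
    fix k assume "k \<in> {..<card I}"
    then have k: "k < card I" by simp
    show "diam_pow M s (V k) \<le> ennreal (d powr s)"
    proof (cases "U (f k) = {}")
      case True then show ?thesis by (simp add: V_def diam_pow_def)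
    next
      case False
      then obtain x where x: "x \<in> U (f k)" by blast
      have "(SUP (x, y)\<in>U (f k) \<times> U (f k). mdist M x y) \<le> d"
        using False d fI[OF k] by (intro cSUP_least) auto
      moreover have "0 \<le> (SUP (x, y)\<in>U (f k) \<times> U (f k). mdist M x y)"
        by (rule order_trans[OF _ cSUP_upper[where x = "(x, x)"]])
           (use x d fI[OF k] in \<open>auto intro!: bdd_aboveI[of _ d]\<close>)
      ultimately have "set_diam M (U (f k)) powr s \<le> d powr s"
        using \<open>0 < s\<close> False by (intro powr_mono2) (auto simp: set_diam_def)
      then show ?thesis
        using \<open>0 < s\<close> k False by (simp add: V_def diam_pow_def ennreal_leI)
    qed
  qed
  also have "\<dots> = ennreal (card I * d powr s)"
    by (simp add: ennreal_mult ennreal_of_nat_eq_real_of_nat)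
  finally show ?thesis .
qed

text \<open>Covers of level \<open>k\<close> cost at most \<open>(N * d powr s) ^ k\<close>, which
  tends to zero, so every \<open>A m\<close> has content zero at every scale. The countable union
  allows for limit sets in which the count \<open>N ^ k\<close> holds only once the first letter is
  fixed.\<close>

lemma hausdorff_dim_le_countable_cover:
  fixes A :: "nat \<Rightarrow> 'p set"
  assumes "0 < s" "0 < d" "d < 1" "N * d powr s < 1"
    and cover: "\<And>m k. \<exists>\<U>. finite \<U> \<and> card \<U> \<le> N ^ k \<and> A m \<subseteq> \<Union>\<U> \<and>
      (\<forall>U\<in>\<U>. U \<subseteq> mspace M \<and> (\<forall>x\<in>U. \<forall>y\<in>U. mdist M x y \<le> d ^ k))"
  shows "hausdorff_dim M (\<Union>m. A m) \<le> ereal s"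
proof -
  have "hausdorff_content M s \<delta> (A m) = 0" if "0 < \<delta>" for \<delta> m
  proof -
    have "hausdorff_content M s \<delta> (A m) \<le> ennreal ((N * d powr s) ^ k)" if k: "d ^ k \<le> \<delta>" for k
    proof -
      obtain \<U> where \<U>: "finite \<U>" "card \<U> \<le> N ^ k" "A m \<subseteq> \<Union>\<U>"
        "\<forall>U\<in>\<U>. U \<subseteq> mspace M \<and> (\<forall>x\<in>U. \<forall>y\<in>U. mdist M x y \<le> d ^ k)"
        using cover[of k m] by (elim exE conjE) (rule that)
      have "hausdorff_content M s \<delta> (A m) \<le> ennreal (card \<U> * (d ^ k) powr s)"
        by (rule hausdorff_content_finite_cover[where U = id])
           (use \<U> k \<open>0 < d\<close> \<open>0 < s\<close> in auto)
      also have "\<dots> \<le> ennreal (N ^ k * (d ^ k) powr s)"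
        using \<U>(2) by (intro ennreal_leI mult_right_mono) auto
      also have "N ^ k * (d ^ k) powr s = (N * d powr s) ^ k"
        using \<open>0 < d\<close> by (simp add: power_mult_distrib powr_realpow[symmetric] powr_powr mult.commute)
      finally show ?thesis .
    qed
    moreover have "\<forall>\<^sub>F k in sequentially. d ^ k \<le> \<delta>"
      using order_tendstoD(2)[OF LIMSEQ_realpow_zero[of d] \<open>0 < \<delta>\<close>] \<open>0 < d\<close> \<open>d < 1\<close>
      by (auto elim: eventually_mono)
    ultimately have "\<forall>\<^sub>F k in sequentially. hausdorff_content M s \<delta> (A m) \<le> ennreal ((N * d powr s) ^ k)"
      by (auto elim: eventually_mono)
    moreover have "(\<lambda>k. ennreal ((N * d powr s) ^ k)) \<longlonglongrightarrow> ennreal 0"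
      using assms by (intro tendsto_ennrealI LIMSEQ_realpow_zero) auto
    ultimately have "hausdorff_content M s \<delta> (A m) \<le> 0"
      by (metis ennreal_0 tendsto_lowerbound sequentially_bot)
    then show ?thesis by simp
  qed
  then have "hausdorff_content M s \<delta> (\<Union>m. A m) = 0" if "0 < \<delta>" for \<delta>
    using hausdorff_content_UN_le[of M s \<delta> A] that by simp
  then have "hausdorff_measure M s (\<Union>m. A m) = 0"
    unfolding hausdorff_measure_def by (auto simp: SUP_eq_iff intro!: SUP_eqI)
  then show ?thesis
    unfolding hausdorff_dim_def using \<open>0 < s\<close> by (intro INF_lower) auto
qed

text \<open>The inverse of \<open>g\<close> is Hoelder continuous, so covers of \<open>A\<close> give covers of the unit interval,
  whose Lebesgue measure bounds the sums of the diameters from below.\<close>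

lemma hausdorff_dim_ge_expanding:
  assumes "0 < s" "0 < C"
    and g: "\<And>x. x \<in> {0..<1} \<Longrightarrow> g x \<in> A"
    and expand: "\<And>x y. x \<in> {0..<1} \<Longrightarrow> y \<in> {0..<1} \<Longrightarrow> \<bar>x - y\<bar> \<le> C * mdist M (g x) (g y) powr s"
  shows "ereal s \<le> hausdorff_dim M A"
  unfolding hausdorff_dim_def
proof (rule INF_greatest, rule ccontr)
  fix t assume "t \<in> {t. 0 \<le> t \<and> hausdorff_measure M t A = 0}" and "\<not> ereal s \<le> ereal t"
  then have t: "0 \<le> t" "t < s" and null: "hausdorff_measure M t A = 0" by auto
  \<comment> \<open>The content at scale \<open>1\<close> bounds the measure from below, and
    diameters at most \<open>1\<close> allow the exponent \<open>s\<close> to be lowered to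
    \<open>t\<close>.\<close>
  have "ennreal (1 / (2 * C)) \<le> hausdorff_content M t 1 A"
    unfolding hausdorff_content_def
  proof (rule INF_greatest)
    fix U assume "U \<in> {U. A \<subseteq> (\<Union>k::nat. U k) \<and>
        (\<forall>k. U k \<subseteq> mspace M \<and> (\<forall>x\<in>U k. \<forall>y\<in>U k. mdist M x y \<le> 1))}"
    then have U: "A \<subseteq> (\<Union>k. U k)" "\<And>k. U k \<subseteq> mspace M"
      "\<And>k x y. x \<in> U k \<Longrightarrow> y \<in> U k \<Longrightarrow> mdist M x y \<le> 1" by auto
    define d where "d k = set_diam M (U k)" for k
    define V where "V k = {x\<in>{0..<1}. g x \<in> U k}" for k
    define v where "v k = (SOME x. x \<in> V k)" for k
    \<comment> \<open>The set \<open>V k\<close> may fail to be measurable. The closed interval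
      around one of its points contains it by the expansion hypothesis.\<close>
    define I where "I k = (if V k = {} then {} else cball (v k) (C * d k powr s))" for k
    have V_sub: "V k \<subseteq> I k" for k
    proof
      fix x assume x: "x \<in> V k"
      then have v: "v k \<in> V k" unfolding v_def by (rule someI)
      have "mdist M (g x) (g (v k)) \<le> (SUP (x, y)\<in>U k \<times> U k. mdist M x y)"
        by (rule cSUP_upper2[where x = "(g x, g (v k))"])
           (use x v U(3) in \<open>auto simp: V_def intro!: bdd_aboveI[of _ 1]\<close>)
      then have "mdist M (g x) (g (v k)) \<le> d k"
        using x by (auto simp: d_def set_diam_def V_def)
      then have "C * mdist M (g x) (g (v k)) powr s \<le> C * d k powr s"
        using assms by (intro mult_left_mono powr_mono2) auto
      then have "\<bar>x - v k\<bar> \<le> C * d k powr s"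
        using expand[of x "v k"] x v by (auto simp: V_def)
      then show "x \<in> I k"
        using x by (auto simp: I_def dist_real_def abs_minus_commute)
    qed
    have meas: "emeasure lborel (I k) \<le> ennreal (2 * C) * diam_pow M t (U k)" for k
    proof (cases "V k = {}")
      case True then show ?thesis by (simp add: I_def)
    next
      case False
      then obtain y where y: "y \<in> U k" by (auto simp: V_def)
      have d0: "0 \<le> d k"
        unfolding d_def set_diam_def
        using y U(3) by (auto intro!: cSUP_upper2[where x = "(y, y)"] bdd_aboveI[of _ 1])
      have d1: "d k \<le> 1"
        unfolding d_def set_diam_def using y U(3) by (auto intro!: cSUP_least)
      have "emeasure lborel (I k) = ennreal (2 * C * d k powr s)"
        using False \<open>0 < C\<close> by (simp add: I_def cball_eq_atLeastAtMost)
      also have "\<dots> = ennreal (2 * C) * ennreal (d k powr s)"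
        using \<open>0 < C\<close> by (simp add: ennreal_mult)
      also have "ennreal (d k powr s) \<le> diam_pow M t (U k)"
      proof (cases "t = 0")
        case True
        have "d k powr s \<le> 1" using d0 d1 \<open>0 < s\<close> by (simp add: powr_le1)
        then show ?thesis using True y by (auto simp: diam_pow_def)
      next
        case False
        have "d k powr s \<le> d k powr t"
          using d0 d1 t by (cases "d k = 0") (auto intro: powr_mono')
        then show ?thesis using False y by (auto simp: diam_pow_def d_def ennreal_leI)
      qed
      finally show ?thesis by (simp add: mult_left_mono)
    qed
    have "1 = emeasure lborel {0..<1::real}" by simp
    also have "\<dots> \<le> emeasure lborel (\<Union>k. I k)"
    proof (rule emeasure_mono)
      show "{0..<1} \<subseteq> (\<Union>k. I k)"
      proof
        fix x :: real assume x: "x \<in> {0..<1}"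
        then obtain k where "g x \<in> U k" using g U(1) by blast
        then have "x \<in> V k" using x by (simp add: V_def)
        then show "x \<in> (\<Union>k. I k)" using V_sub by blast
      qed
    qed (auto simp: I_def)
    also have "\<dots> \<le> (\<Sum>k. emeasure lborel (I k))"
      by (rule emeasure_subadditive_countably) (auto simp: I_def)
    also have "\<dots> \<le> (\<Sum>k. ennreal (2 * C) * diam_pow M t (U k))"
      by (rule suminf_le) (use meas in auto)
    also have "\<dots> = ennreal (2 * C) * (\<Sum>k. diam_pow M t (U k))"
      by (rule ennreal_suminf_cmult)
    finally have "ennreal (1 / (2 * C)) * 1 \<le>
        ennreal (1 / (2 * C)) * (ennreal (2 * C) * (\<Sum>k. diam_pow M t (U k)))"
      by (rule mult_left_mono) simp
    also have "\<dots> = ennreal (1 / (2 * C) * (2 * C)) * (\<Sum>k. diam_pow M t (U k))"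
      using \<open>0 < C\<close> by (subst ennreal_mult) (auto simp: mult.assoc)
    finally show "ennreal (1 / (2 * C)) \<le> (\<Sum>k. diam_pow M t (U k))"
      using \<open>0 < C\<close> by simp
  qed
  also have "\<dots> \<le> hausdorff_measure M t A"
    unfolding hausdorff_measure_def by (rule SUP_upper) simp
  finally show False
    using null \<open>0 < C\<close> by simp
qed


section \<open>Ladder systems on a line\<close>

definition line :: "real \<Rightarrow> finseq"
  where "line x = x *\<^sub>R Abs_finseq (\<lambda>i. if i = 0 then 1 else 0)"

lemma coord_line: "coord (line x) i = (if i = 0 then x else 0)"
proof -
  have "finite {i. (if i = 0 then 1 else 0 :: real) \<noteq> 0}"
    by simp
  then show ?thesis
    by (simp add: line_def Abs_finseq_inverse)
qed

lemma inner_line: "inner (line x) y = x * coord y 0"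
proof -
  have "inner (line x) y = (\<Sum>i\<in>{0}. coord (line x) i * coord y i)"
    by (rule inner_finseq_eq) (auto simp: coord_line)
  then show ?thesis by (simp add: coord_line)
qed

lemma line_add: "line (x + y) = line x + line y"
  and line_scaleR: "line (c * x) = c *\<^sub>R line x"
  and line_0 [simp]: "line 0 = 0"
  and line_diff: "line (x - y) = line x - line y"
  by (auto simp: line_def algebra_simps)

lemma norm_line [simp]: "norm (line x) = \<bar>x\<bar>"
  by (simp add: norm_eq_sqrt_inner inner_line coord_line)

lemma dist_line [simp]: "dist (line x) (line y) = \<bar>x - y\<bar>"
  by (metis dist_norm line_diff norm_line)

lemma line_eq_iff [simp]: "line x = line y \<longleftrightarrow> x = y"
  by (metis coord_line)

lemma line_mem_image [simp]: "line x \<in> line ` A \<longleftrightarrow> x \<in> A"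
  by auto

lemma inj_line: "inj_on line A"
  by (simp add: inj_on_def)

lemma range_line: "range line = span {line 1}"
  by (auto simp: span_singleton line_def image_iff)

lemma subspace_range_line: "subspace (range line)"
  by (simp add: range_line subspace_span)

lemma continuous_line: "continuous_on A line"
  unfolding line_def by (intro continuous_intros)

definition line_metric :: "finseq metric"
  where "line_metric = submetric euclidean_metric (range line)"

lemma mspace_line_metric [simp]: "mspace line_metric = range line"
  and mdist_line_metric [simp]: "mdist line_metric = dist"
  by (auto simp: line_metric_def)

lemma homeomorphic_map_line: "homeomorphic_map euclideanreal (mtopology_of line_metric) line"
proof -
  have "continuous_on (range line) (\<lambda>y. inner (line 1) y)"
    by (intro continuous_intros)
  then have "homeomorphic_maps euclideanreal (mtopology_of line_metric) line (\<lambda>y. inner (line 1) y)"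
    using continuous_line[of UNIV]
    by (auto simp: homeomorphic_maps_def line_metric_def mtopology_of_submetric
        continuous_map_in_subtopology inner_line coord_line)
  then show ?thesis
    by (rule homeomorphic_maps_map[THEN iffD1, THEN conjunct1])
qed

lemma euclidean_ambient_line: "euclidean_ambient line_metric"
proof -
  have "line 1 \<in> range line" "line 1 \<noteq> 0"
    using line_eq_iff[of 1 0] by (auto simp del: line_eq_iff)
  then show ?thesis
    unfolding euclidean_ambient_def
    by (auto simp: range_line intro!: exI[of _ "{line 1}"])
qed

lemma interior_of_line: "mtopology_of line_metric interior_of (line ` A) = line ` interior A"
  using homeomorphic_map_interior_of[OF homeomorphic_map_line, of A] by simp

lemma closure_of_line: "mtopology_of line_metric closure_of (line ` A) = line ` closure A"
  using homeomorphic_map_closure_of[OF homeomorphic_map_line, of A] by simp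

lemma compactin_line: "compactin (mtopology_of line_metric) (line ` A) \<longleftrightarrow> compact A"
  using homeomorphic_map_compactness[OF homeomorphic_map_line, of A] by simp

lemma connectedin_line: "connectedin (mtopology_of line_metric) (line ` A) \<longleftrightarrow> connected A"
  using homeomorphic_map_connectedness[OF homeomorphic_map_line, of A] by simp

lemma openin_line: "openin (mtopology_of line_metric) (line ` A) \<longleftrightarrow> open A"
  using homeomorphic_map_openness[OF homeomorphic_map_line, of A] by simp

lemma has_derivative_affine:
  "((\<lambda>y. c *\<^sub>R y + line b) has_derivative (\<lambda>v. c *\<^sub>R v)) (at p within A)"
  by (auto intro!: derivative_eq_intros)

lemma euclidean_conformal_affine:
  assumes "c > 0"
  shows "euclidean_conformal line_metric (range line) (\<lambda>y. c *\<^sub>R y + line b)"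
  unfolding euclidean_conformal_def
proof (intro conjI exI[of _ "\<lambda>p v. c *\<^sub>R v"] ballI)
  show "inj_on (\<lambda>y. c *\<^sub>R y + line b) (range line)"
    using assms by (auto simp: inj_on_def)
  show "(\<lambda>y. c *\<^sub>R y + line b) ` range line \<subseteq> mspace line_metric"
    by (auto simp flip: line_scaleR line_add)
  show "\<exists>c'>0. \<forall>v\<in>mspace line_metric. norm (c *\<^sub>R v) = c' * norm v"
    using assms by (intro exI[of _ c]) auto
qed (auto intro: has_derivative_affine)

text \<open>The derivative selected by \<open>frechet_derivative\<close> is determined only along
  the axis. Composition with \<open>t \<mapsto> p + t *\<^sub>R v\<close> computes it there, by
  uniqueness of the derivative of a function of one real variable.\<close>

lemma euclidean_deriv_norm_affine:
  assumes "c > 0" "p \<in> range line"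
  shows "euclidean_deriv_norm line_metric (\<lambda>y. c *\<^sub>R y + line b) p = c"
proof -
  let ?f = "\<lambda>y. c *\<^sub>R y + line b"
  define D where "D = frechet_derivative ?f (at p within range line)"
  have D: "(?f has_derivative D) (at p within range line)"
    unfolding D_def
    using has_derivative_affine[of c b p "range line"]
    by (meson differentiable_def frechet_derivative_works)
  have D_eq: "D v = c *\<^sub>R v" if v: "v \<in> range line" for v
  proof -
    have seg: "((\<lambda>t::real. p + t *\<^sub>R v) has_derivative (\<lambda>t. t *\<^sub>R v)) (at 0)"
      by (auto intro!: derivative_eq_intros)
    have "range (\<lambda>t::real. p + t *\<^sub>R v) \<subseteq> range line"
      using assms(2) v subspace_range_line by (auto intro: subspace_add subspace_scale)
    then have "(?f has_derivative D) (at (p + 0 *\<^sub>R v) within range (\<lambda>t::real. p + t *\<^sub>R v))"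
      using has_derivative_subset[OF D] by simp
    from has_derivative_in_compose[OF seg this]
    have "((\<lambda>t. ?f (p + t *\<^sub>R v)) has_derivative (\<lambda>t. D (t *\<^sub>R v))) (at 0)" .
    moreover have "((\<lambda>t. ?f (p + t *\<^sub>R v)) has_derivative (\<lambda>t. c *\<^sub>R t *\<^sub>R v)) (at 0)"
      by (auto intro!: derivative_eq_intros)
    ultimately have "(\<lambda>t. D (t *\<^sub>R v)) = (\<lambda>t. c *\<^sub>R t *\<^sub>R v)"
      by (rule has_derivative_unique)
    from fun_cong[OF this, of 1] show ?thesis by simp
  qed
  have "norm (D v) = c" if "v \<in> {v \<in> range line. norm v = 1}" for v
    using that assms(1) by (auto simp: D_eq)
  moreover have "line 1 \<in> {v \<in> range line. norm v = 1}" by auto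
  ultimately have "(SUP v\<in>{v \<in> range line. norm v = 1}. norm (D v)) = (SUP v\<in>{v \<in> range line. norm v = 1}. c)"
    by (intro SUP_cong) auto
  also have "\<dots> = c"
    using \<open>line 1 \<in> _\<close> by (intro cSUP_const) blast
  finally show ?thesis
    by (simp add: euclidean_deriv_norm_def D_def)
qed

text \<open>Letters \<open>0\<close> and \<open>1\<close>, of ratio \<open>1/4\<close>, get the
  outer quarters of the unit interval. The rungs start at points that decrease from
  \<open>1/2\<close> towards \<open>1/4\<close>.\<close>

definition offset :: "nat \<Rightarrow> real"
  where "offset e = (if e = 0 then 0 else if e = 1 then 3/4 else 1/4 + 1 / (4 * (real e - 1)))"

text \<open>The clause for \<open>0\<close> in \<open>inc\<close> makes \<open>1\<close> the only
  way from \<open>0\<close> to a rung. Affine generators are conformal on the whole axis with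
  constant derivative norm, so any compact neighbourhood of the unit interval can serve as
  \<open>Sset\<close>.\<close>

definition ladder_system :: "(nat \<Rightarrow> real) \<Rightarrow> (nat \<Rightarrow> nat \<Rightarrow> bool) \<Rightarrow> (nat, nat, finseq) gdms"
  where "ladder_system r K =
    \<lparr>edges = UNIV, verts = {0},
     inc = (\<lambda>a b. if a = 0 then b \<le> 1 else if a = 1 then True else b = 0 \<or> (2 \<le> b \<and> K a b)),
     ini = (\<lambda>_. 0), ter = (\<lambda>_. 0), amb = Euclidean line_metric,
     Xset = (\<lambda>_. line ` {0..1}), Wset = (\<lambda>_. range line), Sset = (\<lambda>_. line ` {-1..2}),
     phi = (\<lambda>e y. r e *\<^sub>R y + line (offset e))\<rparr>"

text \<open>The quadratic bound on the ratios fits the gaps between consecutive offsets. The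
  condition \<open>step\<close> limits the branching among rungs to two and the climb to one rung
  per letter.\<close>

locale ladder =
  fixes r :: "nat \<Rightarrow> real" and K :: "nat \<Rightarrow> nat \<Rightarrow> bool"
  assumes ratio_special: "r 0 = 1/4" "r 1 = 1/4"
    and ratio_rung: "\<And>k. 2 \<le> k \<Longrightarrow> 0 < r k" "\<And>k. 2 \<le> k \<Longrightarrow> r k \<le> 1 / (16 * (real k - 1)\<^sup>2)"
    and step: "\<And>a b. K a b \<Longrightarrow> a = Suc b \<or> b = Suc a"
begin

abbreviation "Sys \<equiv> ladder_system r K"

section \<open>Position of the first-level intervals\<close>

lemma ratio_rung_le: "2 \<le> k \<Longrightarrow> r k \<le> 1/16"
proof -
  assume k: "2 \<le> k"
  then have "1 \<le> (real k - 1)\<^sup>2" by (intro one_le_power) auto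
  then have "1 / (16 * (real k - 1)\<^sup>2) \<le> 1 / 16"
    by (intro divide_left_mono) auto
  then show ?thesis using ratio_rung(2)[OF k] by simp
qed

lemma nat_special_cases: "k = 0 \<or> k = 1 \<or> 2 \<le> (k::nat)"
  by auto

lemma ratio_pos: "0 < r k"
  using nat_special_cases[of k] ratio_special ratio_rung(1)[of k] by auto

lemma ratio_le: "r k \<le> 1/4"
  using nat_special_cases[of k] ratio_special ratio_rung_le[of k] by auto

lemma offset_rung:
  assumes "2 \<le> k"
  shows "1/4 < offset k" "offset k \<le> 1/2"
proof -
  have "1 \<le> real k - 1" using assms by linarith
  then show "1/4 < offset k" "offset k \<le> 1/2"
    using assms by (auto simp: offset_def field_simps)
qed

lemma offset_bounds: "0 \<le> offset k" "offset k + r k \<le> 1"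
  using nat_special_cases[of k] ratio_special ratio_rung_le[of k] offset_rung[of k]
  by (auto simp: offset_def)

text \<open>With \<open>j = real l - 1\<close>, the starts of the rungs \<open>l - 1\<close> and
  \<open>l\<close> differ by \<open>1 / (4 * j * (j - 1))\<close>, which is more than the bound
  \<open>1 / (16 * j\<^sup>2)\<close> on the length at \<open>l\<close>.\<close>

lemma offset_antimono:
  assumes "2 \<le> k" "k < l"
  shows "offset l + r l \<le> offset k"
proof -
  define j where "j = real l - 1"
  have j: "real k - 1 \<le> j - 1" "2 \<le> j" "1 \<le> real k - 1"
    using assms by (auto simp: j_def)
  have "1 / (4 * j) + 1 / (16 * j\<^sup>2) \<le> 1 / (4 * (j - 1))"
    using j by (simp add: divide_simps power2_eq_square) (simp add: algebra_simps)
  also have "\<dots> \<le> 1 / (4 * (real k - 1))"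
    using j by (intro divide_left_mono) auto
  finally show ?thesis
    using assms ratio_rung(2)[of l] by (simp add: offset_def j_def)
qed

text \<open>From left to right come the interval of \<open>0\<close>, those of the rungs by
  decreasing index, and that of \<open>1\<close>.\<close>

lemma images_disjoint:
  assumes "a \<noteq> b"
  shows "{offset a<..<offset a + r a} \<inter> {offset b<..<offset b + r b} = {}"
proof -
  have "offset b + r b \<le> offset a \<or> offset a + r a \<le> offset b" if ab: "a < b" for a b
  proof -
    consider "a = 0" "b = 1" | "a = 0" "2 \<le> b" | "a = 1" "2 \<le> b" | "2 \<le> a"
      using ab by linarith
    then show ?thesis
      using that ratio_special offset_rung[of b] ratio_rung_le[of b] offset_antimono[of a b]
      by cases (auto simp: offset_def[of 0] offset_def[of "Suc 0"])
  qed
  from this[of a b] this[of b a] assms show ?thesis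
    by (auto simp: nat_neq_iff)
qed

section \<open>Ladder systems are conformal GDMSs\<close>

lemma Sys_simps [simp]:
  "edges Sys = UNIV" "verts Sys = {0}" "ini Sys e = 0" "ter Sys e = 0"
  "amb Sys = Euclidean line_metric" "Xset Sys v = line ` {0..1}" "Wset Sys v = range line"
  "Sset Sys v = line ` {-1..2}" "phi Sys e = (\<lambda>y. r e *\<^sub>R y + line (offset e))"
  by (simp_all add: ladder_system_def)

lemma inc_Sys:
  "inc Sys a b \<longleftrightarrow> (if a = 0 then b \<le> 1 else if a = 1 then True else b = 0 \<or> (2 \<le> b \<and> K a b))"
  by (simp add: ladder_system_def)

lemma affine_line: "c *\<^sub>R line x + line b = line (c * x + b)"
  by (simp add: line_add line_scaleR)

lemma ratio_times_bounds:
  assumes "x \<in> {0..1}"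
  shows "0 \<le> r e * x" "r e * x \<le> r e"
  using assms ratio_pos[of e] by (auto simp: mult_left_le)

lemma is_gdms_Sys: "is_gdms Sys"
proof -
  have "r e * x + offset e \<in> {0..1}" if "x \<in> {0..1}" for x e
    using ratio_times_bounds[OF that, of e] offset_bounds[of e] by simp
  then have "phi Sys e ` line ` {0..1} \<subseteq> line ` {0..1}" for e
    by (auto simp: affine_line)
  moreover have "inj_on (phi Sys e) A" for e A
    using ratio_pos[of e] by (auto simp: inj_on_def)
  moreover have "dist (phi Sys e x) (phi Sys e y) \<le> 1/4 * dist x y" for e x y
  proof -
    have "dist (phi Sys e x) (phi Sys e y) = r e * dist x y"
      using ratio_pos[of e] by (simp add: dist_norm flip: scaleR_diff_right)
    then show ?thesis
      using mult_right_mono[OF ratio_le[of e] zero_le_dist[of x y]] by simp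
  qed
  moreover have "(0::real) < 1/4" "(1/4::real) < 1" by simp_all
  ultimately have "\<exists>s. 0 < s \<and> s < 1 \<and> (\<forall>e\<in>edges Sys. phi Sys e ` Xset Sys (ter Sys e) \<subseteq> Xset Sys (ini Sys e) \<and>
          inj_on (phi Sys e) (Xset Sys (ter Sys e)) \<and>
          (\<forall>x\<in>Xset Sys (ter Sys e). \<forall>y\<in>Xset Sys (ter Sys e).
             mdist (amb_metric (amb Sys)) (phi Sys e x) (phi Sys e y)
               \<le> s * mdist (amb_metric (amb Sys)) x y))"
    by (intro exI[of _ "1/4"]) (simp del: Sys_simps(9))
  then show ?thesis
    unfolding is_gdms_def by (simp add: compactin_line)
qed

lemma conformal_gdms_Sys: "conformal_gdms Sys"
proof -
  have "phi Sys a ` line ` {0<..<1} \<inter> phi Sys b ` line ` {0<..<1} = {}" if "a \<noteq> b" for a b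
  proof -
    have sub: "phi Sys e ` line ` {0<..<1} \<subseteq> line ` {offset e<..<offset e + r e}" for e
      using ratio_pos[of e] by (auto simp: affine_line)
    have "line ` {offset a<..<offset a + r a} \<inter> line ` {offset b<..<offset b + r b} = {}"
      using images_disjoint[OF that] by (simp add: image_Int[OF inj_line, symmetric])
    then show ?thesis
      using sub[of a] sub[of b] by blast
  qed
  moreover have "phi Sys e ` range line \<subseteq> range line" for e
    by (auto simp: affine_line)
  moreover have "line ` {0..1} \<subseteq> line ` {-1<..<2}"
    by (intro image_mono) auto
  moreover have "conformal_on (amb Sys) (range line) (phi Sys e)" for e
    unfolding Sys_simps conformal_on.simps by (rule euclidean_conformal_affine[OF ratio_pos])
  ultimately show ?thesis
    unfolding conformal_gdms_def
    using is_gdms_Sys openin_line[of UNIV] connectedin_line[of UNIV]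
    by (simp add: euclidean_ambient_line interior_of_line closure_of_line connectedin_line compactin_line
        image_mono del: Sys_simps(9))
qed

end


section \<open>Dimensions of limit sets\<close>

lemma frac_double: "frac (2 * z) = 2 * frac z - (if frac z < 1/2 then 0 else (1::real))"
proof -
  have "2 * z - (2 * frac z - (if frac z < 1/2 then 0 else 1)) =
      of_int (2 * \<lfloor>z\<rfloor> + (if frac z < 1/2 then 0 else 1))"
    by (simp add: frac_def)
  then show ?thesis
    using frac_ge_0[of z] frac_lt_1[of z] by (auto simp: frac_unique_iff simp del: of_int_add of_int_mult)
qed

definition binary_digit :: "real \<Rightarrow> nat \<Rightarrow> nat"
  where "binary_digit x n = (if frac (2 ^ n * x) < 1/2 then 0 else 1)"

text \<open>Equal digits cancel under doubling, so \<open>2 ^ n * (x - y)\<close> stays the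
  difference of the fractional parts of \<open>2 ^ n * x\<close> and \<open>2 ^ n * y\<close>, which
  is at most \<open>1\<close> in absolute value.\<close>

lemma binary_digits_agree:
  assumes "x \<in> {0..<1}" "y \<in> {0..<1}" "\<And>k. k < n \<Longrightarrow> binary_digit x k = binary_digit y k"
  shows "\<bar>x - y\<bar> \<le> (1/2) ^ n"
proof -
  have "2 ^ n * (x - y) = frac (2 ^ n * x) - frac (2 ^ n * y)"
    using assms(3)
  proof (induction n)
    case 0
    then show ?case using assms(1,2) by (simp add: frac_eq)
  next
    case (Suc n)
    have "frac (2 ^ Suc n * z) = 2 * frac (2 ^ n * z) - real (binary_digit z n)" for z
      using frac_double[of "2 ^ n * z"] by (simp add: binary_digit_def mult.assoc)
    note step = this
    have "2 ^ Suc n * (x - y) = 2 * (2 ^ n * (x - y))"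
      by simp
    also have "\<dots> = 2 * frac (2 ^ n * x) - 2 * frac (2 ^ n * y)"
      using Suc by simp
    also have "\<dots> = frac (2 ^ Suc n * x) - frac (2 ^ Suc n * y)"
      unfolding step using Suc.prems[of n] by simp
    finally show ?case .
  qed
  moreover have "\<bar>frac (2 ^ n * x) - frac (2 ^ n * y)\<bar> \<le> 1"
    using frac_ge_0[of "2 ^ n * x"] frac_lt_1[of "2 ^ n * x"] frac_ge_0[of "2 ^ n * y"]
      frac_lt_1[of "2 ^ n * y"] by linarith
  ultimately have "2 ^ n * \<bar>x - y\<bar> \<le> 1"
    by (metis abs_mult abs_numeral power_abs)
  then show ?thesis by (simp add: power_one_over field_simps)
qed

text \<open>A superset of the walks with \<open>n\<close> vertices starting at \<open>m\<close>
  suffices for an upper bound on their number: at \<open>0\<close> the truncated subtraction adds a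
  step that stays at \<open>0\<close>.\<close>

primrec ladder_walks :: "nat \<Rightarrow> nat \<Rightarrow> nat list set"
  where
    "ladder_walks 0 m = {[]}"
  | "ladder_walks (Suc n) m = (#) m ` (ladder_walks n (m + 1) \<union> ladder_walks n (m - 1))"

lemma finite_ladder_walks: "finite (ladder_walks n m)"
  by (induction n arbitrary: m) auto

lemma card_ladder_walks: "card (ladder_walks n m) \<le> 2 ^ n"
proof (induction n arbitrary: m)
  case (Suc n)
  have "card (ladder_walks (Suc n) m) \<le> card (ladder_walks n (m + 1) \<union> ladder_walks n (m - 1))"
    by (simp add: card_image_le finite_ladder_walks)
  also have "\<dots> \<le> card (ladder_walks n (m + 1)) + card (ladder_walks n (m - 1))"
    by (rule card_Un_le)
  also have "\<dots> \<le> 2 ^ Suc n"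
    using Suc[of "m + 1"] Suc[of "m - 1"] by simp
  finally show ?case .
qed simp

lemma prefix_in_ladder_walks:
  assumes "\<And>k. \<omega> k = Suc (\<omega> (Suc k)) \<or> \<omega> (Suc k) = Suc (\<omega> k)"
  shows "map \<omega> [0..<n] \<in> ladder_walks n (\<omega> 0)"
  using assms
proof (induction n arbitrary: \<omega>)
  case (Suc n)
  have "map \<omega> [0..<Suc n] = \<omega> 0 # map (\<lambda>k. \<omega> (Suc k)) [0..<n]"
    by (simp add: map_upt_Suc del: upt_Suc)
  moreover have "map (\<lambda>k. \<omega> (Suc k)) [0..<n] \<in> ladder_walks n (\<omega> (Suc 0))"
    by (rule Suc.IH) (rule Suc.prems)
  moreover have "\<omega> (Suc 0) = \<omega> 0 + 1 \<or> \<omega> (Suc 0) = \<omega> 0 - 1"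
    using Suc.prems[of 0] by auto
  ultimately show ?case
    by (auto simp del: upt_Suc)
qed simp

section \<open>Cylinder intervals, the coding map and the two dimension bounds\<close>

context ladder begin

definition rate :: "nat list \<Rightarrow> real"
  where "rate w = prod_list (map r w)"

text \<open>The translation part of the affine map \<open>word_map Sys w\<close>, whose linear part
  is \<open>rate w\<close>.\<close>

primrec shift :: "nat list \<Rightarrow> real"
  where
    "shift [] = 0"
  | "shift (e # w) = r e * shift w + offset e"

definition cyl :: "nat list \<Rightarrow> real set"
  where "cyl w = {shift w..shift w + rate w}"

lemma rate_simps [simp]: "rate [] = 1" "rate (e # w) = r e * rate w" "rate (u @ v) = rate u * rate v"
  by (simp_all add: rate_def)

lemma word_map_eq: "word_map Sys w y = rate w *\<^sub>R y + line (shift w)"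
  by (induction w) (simp_all add: word_map_def scaleR_add_right line_add line_scaleR)

lemma shift_append: "shift (u @ v) = shift u + rate u * shift v"
  by (induction u) (simp_all add: algebra_simps)

lemma rate_pos: "0 < rate w"
  by (induction w) (simp_all add: ratio_pos)

lemma rate_le: "rate w \<le> (1/4) ^ length w"
proof (induction w)
  case (Cons e w)
  have "r e * rate w \<le> 1/4 * (1/4) ^ length w"
    using Cons rate_pos[of w] by (intro mult_mono ratio_le) auto
  then show ?case by simp
qed simp

lemma rate_le_rungs: "set w \<subseteq> {2..} \<Longrightarrow> rate w \<le> (1/16) ^ length w"
proof (induction w)
  case (Cons e w)
  have "r e * rate w \<le> 1/16 * (1/16) ^ length w"
    using Cons rate_pos[of w] by (intro mult_mono ratio_rung_le) auto
  then show ?case by simp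
qed simp

lemma shift_bounds: "0 \<le> shift w" "shift w + rate w \<le> 1"
proof (induction w)
  case (Cons e w)
  {
    case 1
    then show ?case using Cons ratio_pos[of e] offset_bounds[of e] by simp
  next
    case 2
    have "r e * (shift w + rate w) \<le> r e * 1"
      using Cons ratio_pos[of e] by (intro mult_left_mono) auto
    then show ?case using offset_bounds[of e] by (simp add: algebra_simps)
  }
qed simp_all

lemma word_map_image: "word_map Sys w ` line ` {0..1} = line ` cyl w"
proof -
  have "(\<lambda>x. rate w * x + shift w) ` {0..1} = cyl w"
    using rate_pos[of w] by (simp add: cyl_def image_affinity_atLeastAtMost add.commute[of "rate w" "shift w"])
  moreover have "word_map Sys w ` line ` {0..1} = line ` (\<lambda>x. rate w * x + shift w) ` {0..1}"
    by (simp add: image_image word_map_eq affine_line)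
  ultimately show ?thesis by simp
qed

lemma cyl_append: "cyl (u @ v) \<subseteq> cyl u"
proof -
  have "rate u * (shift v + rate v) \<le> rate u * 1" "0 \<le> rate u * shift v"
    using shift_bounds[of v] rate_pos[of u] by (auto intro!: mult_left_mono)
  then show ?thesis
    by (auto simp: cyl_def shift_append algebra_simps)
qed

text \<open>The cylinders of the prefixes are nested closed intervals of length at most
  \<open>(1/4) ^ n\<close>. They meet in a single point, so \<open>the_elem\<close> in
  \<open>coding\<close> is meaningful.\<close>

lemma coding_in_cyl: "\<exists>a. coding Sys \<omega> = line a \<and> (\<forall>n. a \<in> cyl (map \<omega> [0..<n]))"
proof -
  let ?I = "\<lambda>n. cyl (map \<omega> [0..<n])"
  have mono: "?I n \<subseteq> ?I m" if "m \<le> n" for m n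
  proof -
    have "map \<omega> [0..<n] = map \<omega> [0..<m] @ map \<omega> [m..<n]"
      using that upt_add_eq_append[of 0 m "n - m"] by simp
    then show ?thesis using cyl_append by simp
  qed
  have "\<exists>a. \<Inter>(range ?I) = {a}"
  proof (rule decreasing_closed_nest_sing)
    fix e :: real assume "0 < e"
    then obtain n where "(1/4) ^ n < e"
      using real_arch_pow_inv[of e "1/4"] by auto
    moreover have "rate (map \<omega> [0..<n]) \<le> (1/4) ^ n"
      using rate_le[of "map \<omega> [0..<n]"] by simp
    ultimately have "dist x y < e" if "x \<in> ?I n" "y \<in> ?I n" for x y
      using that by (auto simp: cyl_def dist_real_def)
    then show "\<exists>n. \<forall>x\<in>?I n. \<forall>y\<in>?I n. dist x y < e" by blast
  qed (use mono rate_pos in \<open>auto simp: cyl_def less_imp_le\<close>)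
  then obtain a where a: "\<Inter>(range ?I) = {a}" by blast
  have "(\<Inter>n\<in>{1..}. line ` ?I n) = line ` (\<Inter>n\<in>{1..}. ?I n)"
    by (rule image_INT[symmetric, where C = UNIV]) (auto simp: inj_line)
  \<comment> \<open>The intersection in \<open>coding\<close> starts at \<open>n = 1\<close>;
    nestedness adds the empty prefix.\<close>
  also have "(\<Inter>n\<in>{1..}. ?I n) = \<Inter>(range ?I)"
  proof
    show "(\<Inter>n\<in>{1..}. ?I n) \<subseteq> \<Inter>(range ?I)"
    proof (intro INT_greatest)
      fix n
      have "(\<Inter>n\<in>{1..}. ?I n) \<subseteq> ?I (Suc n)" by (rule INT_lower) simp
      also have "\<dots> \<subseteq> ?I n" by (rule mono) simp
      finally show "(\<Inter>n\<in>{1..}. ?I n) \<subseteq> ?I n" .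
    qed
  qed blast
  finally have "(\<Inter>n\<in>{1..}. word_map Sys (map \<omega> [0..<n]) ` Xset Sys (ter Sys (\<omega> (n - 1)))) = {line a}"
    by (simp add: a word_map_image)
  then have "coding Sys \<omega> = line a"
    unfolding coding_def by simp
  then show ?thesis using a by blast
qed

text \<open>Binary digits, read as words over \<open>0\<close> and \<open>1\<close>, give the map
  for \<open>hausdorff_dim_ge_expanding\<close>. If the digits of \<open>x\<close> and
  \<open>y\<close> first differ at position \<open>n\<close>, then \<open>x\<close> and
  \<open>y\<close> are within \<open>(1/2) ^ n\<close>, while the coded points are at least
  \<open>(1/4) ^ (n + 1)\<close> apart. Taking the square root yields the constant
  \<open>2\<close>.\<close>

lemma limit_dim_ge_half:
  assumes "{0, 1} \<subseteq> F"
  shows "ereal (1/2) \<le> limit_dim Sys F"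
proof -
  have "ereal (1/2) \<le> hausdorff_dim line_metric (limit_set Sys F)"
  proof (rule hausdorff_dim_ge_expanding[where C = 2 and g = "\<lambda>x. coding Sys (binary_digit x)"])
    fix x :: real
    have "binary_digit x \<in> inf_words Sys F"
      using assms by (auto simp: inf_words_def inc_Sys binary_digit_def)
    then show "coding Sys (binary_digit x) \<in> limit_set Sys F"
      by (simp add: limit_set_def)
  next
    fix x y :: real assume xy: "x \<in> {0..<1}" "y \<in> {0..<1}"
    obtain a where a: "coding Sys (binary_digit x) = line a" "\<And>n. a \<in> cyl (map (binary_digit x) [0..<n])"
      using coding_in_cyl by blast
    obtain b where b: "coding Sys (binary_digit y) = line b" "\<And>n. b \<in> cyl (map (binary_digit y) [0..<n])"
      using coding_in_cyl by blast
    have "\<bar>x - y\<bar> \<le> 2 * \<bar>a - b\<bar> powr (1/2)"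
    proof (cases "x = y")
      case False
      have "\<exists>n. binary_digit x n \<noteq> binary_digit y n"
      proof (rule ccontr)
        assume "\<not> ?thesis"
        then have "\<bar>x - y\<bar> \<le> (1/2) ^ n" for n
          using binary_digits_agree[OF xy] by blast
        moreover obtain n where "(1/2) ^ n < \<bar>x - y\<bar>"
          using real_arch_pow_inv[of "\<bar>x - y\<bar>" "1/2"] False by auto
        ultimately show False by (metis not_less)
      qed
      then obtain n where n: "binary_digit x n \<noteq> binary_digit y n"
        and agree: "\<And>k. k < n \<Longrightarrow> binary_digit x k = binary_digit y k"
        unfolding exists_least_iff[of "\<lambda>n. binary_digit x n \<noteq> binary_digit y n"] by auto
      define p where "p = map (binary_digit x) [0..<n]"
      have p: "map (binary_digit y) [0..<n] = p"
        using agree by (simp add: p_def)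
      have "set w \<subseteq> {0, 1} \<Longrightarrow> rate w = (1/4) ^ length w" for w
        by (induction w) (auto simp: ratio_special ratio_special(2)[unfolded One_nat_def])
      moreover have "set p \<subseteq> {0, 1}"
        by (auto simp: p_def binary_digit_def)
      ultimately have rate_p: "rate p = (1/4) ^ n"
        by (simp add: p_def)
      have "a \<in> cyl (p @ [binary_digit x n])" "b \<in> cyl (p @ [binary_digit y n])"
        using a(2)[of "Suc n"] b(2)[of "Suc n"] p by (simp_all add: p_def)
      \<comment> \<open>The two points lie in opposite outer quarters of the cylinder of
        \<open>p\<close>, hence half its length apart. The weaker factor \<open>1/4\<close> makes
        the bound a perfect square.\<close>
      then have ab: "(1/4) ^ n * (1/4) \<le> \<bar>a - b\<bar>"
        using n by (auto simp: cyl_def shift_append rate_p offset_def ratio_special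
            ratio_special(2)[unfolded One_nat_def] binary_digit_def
            split: if_splits)
      have "((1/2) ^ n / 2)\<^sup>2 = (1/4) ^ n * (1/4::real)"
        by (simp add: power_divide power2_eq_square flip: power_mult_distrib)
      then have "(1/2) ^ n / 2 \<le> sqrt \<bar>a - b\<bar>"
        using ab by (intro real_le_rsqrt) simp
      then show ?thesis
        using order_trans[OF binary_digits_agree[OF xy agree, of n]] by (simp add: powr_half_sqrt)
    qed simp
    then show "\<bar>x - y\<bar> \<le> 2 * mdist line_metric (coding Sys (binary_digit x)) (coding Sys (binary_digit y)) powr (1/2)"
      by (simp add: a b)
  qed auto
  then show ?thesis by (simp add: limit_dim_def)
qed

text \<open>Words over the rungs are walks between neighbours. For a fixed first letter there are at
  most \<open>2 ^ k\<close> prefixes of length \<open>k\<close>, and their cylinders have length at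
  most \<open>(1/16) ^ k\<close>.\<close>

lemma limit_dim_rungs_le: "limit_dim Sys {2..} \<le> ereal (1/3)"
proof -
  define A where "A m = coding Sys ` {\<omega> \<in> inf_words Sys {2..}. \<omega> 0 = m}" for m
  have "hausdorff_dim line_metric (\<Union>m. A m) \<le> ereal (1/3)"
  proof (rule hausdorff_dim_le_countable_cover[where N = 2 and d = "1/16"])
    \<comment> \<open>Passing from \<open>1/16\<close> to \<open>1/8\<close> gives a number with
      cube root exactly \<open>1/2\<close>.\<close>
    have "(1/16::real) powr (1/3) < (1/8) powr (1/3)"
      by (rule powr_less_mono2) auto
    also have "(1/8::real) = (1/2) powr 3"
      by (simp add: power3_eq_cube)
    also have "((1/2) powr 3) powr (1/3) = (1/2::real)"
      by (simp only: powr_powr) simp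
    finally show "real 2 * (1/16) powr (1/3) < 1" by simp
  next
    fix m k
    \<comment> \<open>Members of \<open>ladder_walks\<close> may visit \<open>0\<close> and
      \<open>1\<close>, where the contraction is only \<open>1/4\<close>, so the walks are
      restricted to rungs.\<close>
    let ?W = "{w \<in> ladder_walks k m. length w = k \<and> set w \<subseteq> {2..}}"
    let ?\<U> = "(\<lambda>w. line ` cyl w) ` ?W"
    have fin: "finite ?W" using finite_ladder_walks by simp
    have "card ?\<U> \<le> card ?W" by (rule card_image_le[OF fin])
    also have "\<dots> \<le> card (ladder_walks k m)"
      by (rule card_mono) (auto simp: finite_ladder_walks)
    also have "\<dots> \<le> 2 ^ k" by (rule card_ladder_walks)
    finally have "card ?\<U> \<le> 2 ^ k" .
    moreover have "A m \<subseteq> \<Union>?\<U>"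
    proof
      fix z assume "z \<in> A m"
      then obtain \<omega> where \<omega>: "\<omega> \<in> inf_words Sys {2..}" "\<omega> 0 = m" and z: "z = coding Sys \<omega>"
        by (auto simp: A_def)
      obtain a where a: "z = line a" "a \<in> cyl (map \<omega> [0..<k])"
        using coding_in_cyl z by metis
      have ge: "2 \<le> \<omega> j" for j using \<omega>(1) by (auto simp: inf_words_def)
      have inc: "inc Sys (\<omega> j) (\<omega> (Suc j))" for j
        using \<omega>(1) by (auto simp: inf_words_def)
      have "K (\<omega> j) (\<omega> (Suc j))" for j
        using ge[of j] ge[of "Suc j"] inc[of j] by (auto simp: inc_Sys split: if_splits)
      then have "map \<omega> [0..<k] \<in> ladder_walks k m"
        using prefix_in_ladder_walks[of \<omega> k] step \<omega>(2) by blast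
      then have "map \<omega> [0..<k] \<in> ?W"
        using ge by auto
      then show "z \<in> \<Union>?\<U>" using a by blast
    qed
    moreover have "\<forall>U\<in>?\<U>. U \<subseteq> mspace line_metric \<and> (\<forall>x\<in>U. \<forall>y\<in>U. mdist line_metric x y \<le> (1/16) ^ k)"
      using rate_le_rungs by (fastforce simp: cyl_def)
    ultimately show "\<exists>\<U>. finite \<U> \<and> card \<U> \<le> 2 ^ k \<and> A m \<subseteq> \<Union>\<U> \<and>
        (\<forall>U\<in>\<U>. U \<subseteq> mspace line_metric \<and> (\<forall>x\<in>U. \<forall>y\<in>U. mdist line_metric x y \<le> (1/16) ^ k))"
      using fin by blast
  qed auto
  moreover have "limit_set Sys {2..} = (\<Union>m. A m)"
    by (auto simp: limit_set_def A_def)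
  ultimately show ?thesis by (simp add: limit_dim_def)
qed

end


section \<open>Irreducible alphabets\<close>

text \<open>As an integral over the counting measure, the unordered sum in \<open>pressure\<close>
  can be reindexed and iterated. Finite subsets give one inequality, an enumeration by
  \<open>to_nat\<close> the other.\<close>

lemma infsum_eq_nn_integral_count_space:
  fixes f :: "'a::countable \<Rightarrow> ennreal"
  shows "infsum f A = (\<integral>\<^sup>+x. f x \<partial>count_space A)"
proof (rule antisym)
  have sup: "infsum f A = (SUP F\<in>{F. finite F \<and> F \<subseteq> A}. sum f F)"
    by (rule nonneg_infsum_complete) simp
  show "infsum f A \<le> (\<integral>\<^sup>+x. f x \<partial>count_space A)"
    unfolding sup
  proof (rule SUP_least)
    fix F assume "F \<in> {F. finite F \<and> F \<subseteq> A}"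
    then have F: "finite F" "F \<subseteq> A" by auto
    have "sum f F = (\<integral>\<^sup>+x. f x \<partial>count_space F)"
      using F(1) by (simp add: nn_integral_count_space_finite)
    also have "\<dots> = (\<integral>\<^sup>+x. f x * indicator F x \<partial>count_space UNIV)"
      by (simp add: nn_integral_count_space_indicator)
    also have "\<dots> \<le> (\<integral>\<^sup>+x. f x * indicator A x \<partial>count_space UNIV)"
      using F(2) by (intro nn_integral_mono) (auto simp: indicator_def)
    also have "\<dots> = (\<integral>\<^sup>+x. f x \<partial>count_space A)"
      by (simp add: nn_integral_count_space_indicator)
    finally show "sum f F \<le> (\<integral>\<^sup>+x. f x \<partial>count_space A)" .
  qed
  have "(\<integral>\<^sup>+x. f x \<partial>count_space A) = (\<integral>\<^sup>+x. f (from_nat (to_nat x)) \<partial>count_space A)"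
    by simp
  also have "\<dots> = (\<integral>\<^sup>+n. f (from_nat n) \<partial>count_space (to_nat ` A))"
    by (rule nn_integral_bij_count_space[of to_nat A "to_nat ` A" "\<lambda>n. f (from_nat n)"])
       (auto intro: inj_on_imp_bij_betw inj_on_subset[OF inj_to_nat])
  also have "\<dots> = (\<Sum>n. f (from_nat n) * indicator (to_nat ` A) n)"
    by (subst nn_integral_count_space_indicator) (simp_all add: nn_integral_count_space_nat)
  also have "\<dots> = (SUP N. \<Sum>n<N. f (from_nat n) * indicator (to_nat ` A) n)"
    by (rule suminf_eq_SUP)
  also have "\<dots> \<le> infsum f A"
  proof (rule SUP_least)
    fix N
    let ?F = "{x\<in>A. to_nat x < N}"
    have "finite (to_nat ` ?F)" by (rule finite_subset[of _ "{..<N}"]) auto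
    then have fin: "finite ?F" by (rule finite_imageD) (auto intro: inj_on_subset[OF inj_to_nat])
    have "(\<Sum>n<N. f (from_nat n) * indicator (to_nat ` A) n) = (\<Sum>n\<in>to_nat ` ?F. f (from_nat n))"
      by (rule sum.mono_neutral_cong_right) (auto simp: indicator_def)
    also have "\<dots> = sum f ?F"
      by (subst sum.reindex) (auto intro: inj_on_subset[OF inj_to_nat])
    also have "\<dots> \<le> infsum f A"
      unfolding sup using fin by (intro SUP_upper) auto
    finally show "(\<Sum>n<N. f (from_nat n) * indicator (to_nat ` A) n) \<le> infsum f A" .
  qed
  finally show "(\<integral>\<^sup>+x. f x \<partial>count_space A) \<le> infsum f A" .
qed

context ladder begin

lemma word_norm_eq: "word_norm Sys w = rate w"
proof -
  have "word_map Sys w = (\<lambda>y. rate w *\<^sub>R y + line (shift w))"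
    by (simp add: word_map_eq fun_eq_iff)
  then have "word_norm Sys w = (SUP p\<in>line ` {-1..2}. rate w)"
    unfolding word_norm_def Sys_simps deriv_norm.simps
    by (intro SUP_cong) (auto simp: euclidean_deriv_norm_affine rate_pos)
  also have "\<dots> = rate w" by (rule cSUP_const) simp
  finally show ?thesis .
qed

lemma fin_words_iff: "w \<in> fin_words Sys F \<longleftrightarrow> set w \<subseteq> F \<and> successively (inc Sys) w"
  by (auto simp: fin_words_def words_def)

text \<open>Every letter may precede \<open>0\<close> and every letter may follow \<open>1\<close>,
  so the single word \<open>[0, 1]\<close> connects any two letters.\<close>

lemma finitely_irreducible_Sys: "finitely_irreducible_alphabet Sys (edges Sys)"
  unfolding finitely_irreducible_alphabet_def
  by (rule exI[of _ "{[0, 1]}"]) (auto simp: fin_words_iff inc_Sys)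

section \<open>Irreducibility of alphabets that omit \<open>0\<close> or \<open>1\<close>\<close>

lemma last_after_0:
  assumes "successively (inc Sys) (0 # w)" "1 \<notin> set w"
  shows "last (0 # w) = 0"
  using assms
proof (induction w)
  case (Cons a w)
  then have "a = 0" by (auto simp: inc_Sys le_Suc_eq)
  with Cons show ?case by simp
qed simp

text \<open>A rung can be left only towards \<open>0\<close>, and a word that has reached
  \<open>0\<close> stays there until it uses \<open>1\<close>. Without both letters no word leaves
  the rungs and comes back.\<close>

lemma word_stays_on_rungs:
  assumes "\<not> {0, 1} \<subseteq> F" "set w \<subseteq> F" "successively (inc Sys) w" "w \<noteq> []" "2 \<le> hd w" "2 \<le> last w"
  shows "set w \<subseteq> {2..}"
  using assms(2-)
proof (induction w)
  case (Cons a w)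
  show ?case
  proof (cases w)
    case Nil
    then show ?thesis using Cons.prems by simp
  next
    case (Cons b v)
    have "b \<noteq> 0"
    proof
      assume "b = 0"
      then have "last w = 0"
        using last_after_0[of v] Cons Cons.prems assms(1) by auto
      then show False using Cons Cons.prems by simp
    qed
    moreover have "inc Sys a b"
      using Cons Cons.prems by simp
    ultimately have "2 \<le> b"
      using Cons.prems by (auto simp: inc_Sys split: if_splits)
    then have "set w \<subseteq> {2..}"
      using Cons.IH Cons Cons.prems by simp
    then show ?thesis using Cons.prems by simp
  qed
qed simp

text \<open>Each move along \<open>K\<close> climbs by at most one rung, so rung words of bounded
  length cannot connect rungs that are far apart.\<close>

lemma last_rung_le:
  assumes "set w \<subseteq> {2..}" "successively (inc Sys) w" "w \<noteq> []"
  shows "last w \<le> hd w + length w"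
  using assms
proof (induction w)
  case (Cons a w)
  show ?case
  proof (cases w)
    case (Cons b v)
    then have "K a b"
      using Cons.prems by (auto simp: inc_Sys split: if_splits)
    then have "b \<le> Suc a" using step by fastforce
    then show ?thesis using Cons.IH Cons Cons.prems by simp
  qed simp
qed simp

lemma cofinite_unbounded:
  assumes "F \<in> cofinite_subsets Sys"
  obtains m where "m \<in> F" "n \<le> m"
proof -
  have "finite (- F)"
    using assms by (simp add: cofinite_subsets_def Compl_eq_Diff_UNIV)
  then have "infinite F"
    using finite_compl infinite_UNIV_nat by (metis double_compl)
  then show thesis
    using that infinite_nat_iff_unbounded_le by blast
qed

text \<open>With \<open>K\<close> empty no rung follows a rung, so a word from a rung back to itself
  has to leave the rungs.\<close>

lemma irreducible_special:
  assumes "\<And>a b. \<not> K a b" "F \<in> cofinite_subsets Sys" "irreducible_alphabet Sys F"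
  shows "{0, 1} \<subseteq> F"
proof (rule ccontr)
  assume special: "\<not> {0, 1} \<subseteq> F"
  obtain n where n: "n \<in> F" "2 \<le> n" by (rule cofinite_unbounded[OF assms(2)])
  then obtain w where w: "[n] @ w @ [n] \<in> fin_words Sys F"
    using assms(3) unfolding irreducible_alphabet_def by blast
  then have "set ([n] @ w @ [n]) \<subseteq> {2..}"
    using n special by (intro word_stays_on_rungs) (auto simp: fin_words_iff)
  moreover have "inc Sys n (hd (w @ [n]))"
    using w by (simp add: fin_words_iff successively_Cons)
  moreover have "hd (w @ [n]) \<in> set ([n] @ w @ [n])"
    by (cases w) auto
  ultimately show False
    using n(2) assms(1) by (auto simp: inc_Sys split: if_splits)
qed

text \<open>Finitely many connecting words have bounded length, whereas connections inside the rungs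
  get longer with the distance.\<close>

lemma finitely_irreducible_special:
  assumes "F \<in> cofinite_subsets Sys" "finitely_irreducible_alphabet Sys F"
  shows "{0, 1} \<subseteq> F"
proof (rule ccontr)
  assume special: "\<not> {0, 1} \<subseteq> F"
  obtain \<Lambda> where \<Lambda>: "finite \<Lambda>" "\<And>i j. i \<in> F \<Longrightarrow> j \<in> F \<Longrightarrow> \<exists>w\<in>\<Lambda>. [i] @ w @ [j] \<in> fin_words Sys F"
    using assms(2) unfolding finitely_irreducible_alphabet_def by blast
  obtain N where N: "\<And>w. w \<in> \<Lambda> \<Longrightarrow> length w \<le> N"
    using \<Lambda>(1) finite_nat_set_iff_bounded_le[of "length ` \<Lambda>"] by auto
  obtain n where n: "n \<in> F" "2 \<le> n" by (rule cofinite_unbounded[OF assms(1)])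
  \<comment> \<open>With its two end letters the connecting word has length at most
    \<open>N + 2\<close>, so starting from \<open>n\<close> it climbs no higher than
    \<open>n + N + 2\<close>.\<close>
  obtain m where m: "m \<in> F" "n + N + 3 \<le> m" by (rule cofinite_unbounded[OF assms(1)])
  obtain w where w: "w \<in> \<Lambda>" "[n] @ w @ [m] \<in> fin_words Sys F"
    using \<Lambda>(2) n m by blast
  have "set ([n] @ w @ [m]) \<subseteq> {2..}"
    using n m w special by (intro word_stays_on_rungs) (auto simp: fin_words_iff)
  then have "last ([n] @ w @ [m]) \<le> hd ([n] @ w @ [m]) + length ([n] @ w @ [m])"
    using w(2) by (intro last_rung_le) (auto simp: fin_words_iff)
  then show False using N[OF w(1)] m(2) by simp
qed

lemma rungs_cofinite: "{2..} \<in> cofinite_subsets Sys"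
proof -
  have "UNIV - {2..} = {..<2::nat}" by auto
  then show ?thesis by (simp add: cofinite_subsets_def)
qed

text \<open>Neighbouring rungs follow each other in both directions, and concatenating such moves
  connects any two rungs.\<close>

lemma rungs_irreducible:
  assumes "\<And>a. K a (Suc a)" "\<And>a. K (Suc a) a"
  shows "irreducible_alphabet Sys {2..}"
proof -
  let ?P = "\<lambda>i j. \<exists>w. [i] @ w @ [j] \<in> fin_words Sys {2..}"
  have trans: "?P i k" if ij: "?P i j" and jk: "?P j k" for i j k
  proof -
    obtain u v where "[i] @ u @ [j] \<in> fin_words Sys {2..}" "[j] @ v @ [k] \<in> fin_words Sys {2..}"
      using ij jk by blast
    then have "[i] @ (u @ [j] @ v) @ [k] \<in> fin_words Sys {2..}"
      by (auto simp: fin_words_iff hd_append successively_append_iff successively_Cons split: if_splits)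
    then show ?thesis by blast
  qed
  have up: "?P i (Suc i)" and down: "?P (Suc i) i" if "2 \<le> i" for i
    using that assms by (auto simp: fin_words_iff inc_Sys intro!: exI[of _ "[]"])
  have "?P i (i + n)" "?P (i + n) i" if i: "2 \<le> i" for i n
  proof (induction n)
    \<comment> \<open>A connection of \<open>i\<close> with itself contains \<open>i\<close> twice,
      hence the detour through \<open>Suc i\<close>.\<close>
    case 0
    { case 1 show ?case using trans[OF up[OF i] down[OF i]] by simp }
    { case 2 show ?case using trans[OF up[OF i] down[OF i]] by simp }
  next
    case (Suc n)
    { case 1 show ?case using trans[OF Suc(1) up] i by simp }
    { case 2 show ?case using trans[OF down Suc(2)] i by simp }
  qed
  then have "?P i j" if "2 \<le> i" "2 \<le> j" for i j
    using that by (metis le_add_diff_inverse linear)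
  moreover have "w \<in> fin_words Sys {2..}" if "[i] @ w @ [j] \<in> fin_words Sys {2..}" for i j w
    using that by (auto simp: fin_words_iff successively_append_iff successively_Cons)
  ultimately show ?thesis
    unfolding irreducible_alphabet_def
    by (intro exI[of _ "fin_words Sys {2..}"]) (auto; blast)
qed

end


section \<open>Pressure\<close>

context ladder begin

definition partition_sum :: "real \<Rightarrow> nat \<Rightarrow> ennreal"
  where "partition_sum \<tau> n = (\<integral>\<^sup>+w. ennreal (rate w powr \<tau>) * indicator (words Sys UNIV n) w \<partial>count_space UNIV)"

lemma pressure_eq_lim: "pressure Sys \<tau> = lim (\<lambda>n. log_ennreal (partition_sum \<tau> n) / ereal (real n))"
  by (simp add: pressure_def partition_sum_def word_norm_eq infsum_eq_nn_integral_count_space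
      nn_integral_count_space_indicator)

lemma words_snoc_iff:
  assumes "0 < n"
  shows "w @ [b] \<in> words Sys UNIV (Suc n) \<longleftrightarrow> w \<in> words Sys UNIV n \<and> inc Sys (last w) b"
  using assms by (auto simp: words_def successively_append_iff)

text \<open>A positive eigenfunction \<open>h\<close> of the weighted incidence matrix makes the sums weighted by \<open>h\<close>
  at the last letter exactly geometric. The first such sum is itself an eigenvalue equation, since
  letter \<open>1\<close> can be followed by every letter.\<close>

lemma weighted_partition_sum:
  assumes h: "\<And>a. 0 < h a" and "0 < \<rho>"
    and eigen: "\<And>a. (\<lambda>b. if inc Sys a b then r b powr \<tau> * h b else 0) sums (\<rho> * h a)"
  shows "(\<integral>\<^sup>+w. ennreal (rate w powr \<tau> * h (last w)) * indicator (words Sys UNIV (Suc n)) w \<partial>count_space UNIV)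
    = ennreal (\<rho> ^ Suc n * h 1)"
proof -
  define G where "G m w = ennreal (rate w powr \<tau> * h (last w)) * indicator (words Sys UNIV m) w" for m w
  have row: "(\<integral>\<^sup>+b. ennreal (if inc Sys a b then r b powr \<tau> * h b else 0) \<partial>count_space UNIV) = ennreal (\<rho> * h a)"
    for a
    unfolding nn_integral_count_space_nat
    using eigen[of a] h by (intro suminf_ennreal_eq) (auto simp: less_imp_le)
  have "(\<integral>\<^sup>+w. G (Suc n) w \<partial>count_space UNIV) = ennreal (\<rho> ^ Suc n * h 1)"
  proof (induction n)
    case 0
    have words1: "words Sys UNIV (Suc 0) = range (\<lambda>b. [b])"
      by (auto simp: words_def length_Suc_conv)
    have "(\<integral>\<^sup>+w. G 1 w \<partial>count_space UNIV) =
        (\<integral>\<^sup>+w. ennreal (rate w powr \<tau> * h (last w)) \<partial>count_space (range (\<lambda>b. [b])))"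
      by (simp add: G_def words1 nn_integral_count_space_indicator)
    also have "\<dots> = (\<integral>\<^sup>+b. ennreal (rate [b] powr \<tau> * h (last [b])) \<partial>count_space UNIV)"
      by (rule nn_integral_bij_count_space[symmetric]) (auto intro!: inj_on_imp_bij_betw injI)
    also have "\<dots> = ennreal (\<rho> * h 1)"
      using row[of 1] by (simp add: inc_Sys)
    finally show ?case by simp
  next
    case (Suc n)
    \<comment> \<open>Splitting off the last letter turns the sum over words into an iterated sum
      whose inner sum is the eigenvalue equation at \<open>last w\<close>.\<close>
    have bij: "bij_betw (\<lambda>(w, b). w @ [b]) UNIV {w :: nat list. w \<noteq> []}"
      by (rule bij_betwI[where g = "\<lambda>w. (butlast w, last w)"]) auto
    have "(\<integral>\<^sup>+w. G (Suc (Suc n)) w \<partial>count_space UNIV) = (\<integral>\<^sup>+w. G (Suc (Suc n)) w \<partial>count_space {w. w \<noteq> []})"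
      by (rule nn_integral_count_space_eq) (auto simp: G_def words_def)
    also have "\<dots> = (\<integral>\<^sup>+(w, b). G (Suc (Suc n)) (w @ [b]) \<partial>count_space UNIV)"
      using nn_integral_bij_count_space[OF bij, of "G (Suc (Suc n))"] by (simp add: case_prod_unfold)
    also have "\<dots> = (\<integral>\<^sup>+w. \<integral>\<^sup>+b. G (Suc (Suc n)) (w @ [b]) \<partial>count_space UNIV \<partial>count_space UNIV)"
      by (subst nn_integral_fst_count_space[symmetric]) simp
    also have "\<dots> = (\<integral>\<^sup>+w. ennreal \<rho> * G (Suc n) w \<partial>count_space UNIV)"
    proof (rule nn_integral_cong)
      fix w
      define c where "c = ennreal (rate w powr \<tau>) * indicator (words Sys UNIV (Suc n)) w"
      have "G (Suc (Suc n)) (w @ [b]) = c * ennreal (if inc Sys (last w) b then r b powr \<tau> * h b else 0)" for b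
        using rate_pos[of w] ratio_pos[of b] h[of b]
        by (auto simp: G_def c_def words_snoc_iff indicator_def powr_mult ennreal_mult' less_imp_le mult.assoc)
      then have "(\<integral>\<^sup>+b. G (Suc (Suc n)) (w @ [b]) \<partial>count_space UNIV) = c * ennreal (\<rho> * h (last w))"
        by (simp add: nn_integral_cmult row)
      also have "\<dots> = ennreal \<rho> * G (Suc n) w"
        using \<open>0 < \<rho>\<close> h[of "last w"] by (simp add: c_def G_def ennreal_mult less_imp_le mult_ac)
      finally show "(\<integral>\<^sup>+b. G (Suc (Suc n)) (w @ [b]) \<partial>count_space UNIV) = ennreal \<rho> * G (Suc n) w" .
    qed
    also have "\<dots> = ennreal \<rho> * ennreal (\<rho> ^ Suc n * h 1)"
      by (simp add: nn_integral_cmult Suc)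
    also have "\<dots> = ennreal (\<rho> ^ Suc (Suc n) * h 1)"
      using \<open>0 < \<rho>\<close> by (subst ennreal_mult'[symmetric]) (auto simp: mult.assoc)
    finally show ?case .
  qed
  then show ?thesis by (simp add: G_def)
qed

text \<open>Since \<open>h\<close> lies between positive constants, the partition sums agree with
  \<open>\<rho> ^ n\<close> up to constant factors. These disappear after taking logarithms and
  dividing by \<open>n\<close>.\<close>

lemma pressure_eq_ln_eigenvalue:
  assumes h: "\<And>a. c \<le> h a" "\<And>a. h a \<le> C" and "0 < c" "0 < \<rho>"
    and eigen: "\<And>a. (\<lambda>b. if inc Sys a b then r b powr \<tau> * h b else 0) sums (\<rho> * h a)"
  shows "pressure Sys \<tau> = ereal (ln \<rho>)"
proof -
  have h_pos: "0 < h a" for a using h(1)[of a] \<open>0 < c\<close> by linarith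
  have C: "0 < C" using h_pos[of 0] h(2)[of 0] by linarith
  have bounds: "\<exists>z. partition_sum \<tau> n = ennreal z \<and> \<rho> ^ n * (h 1 / C) \<le> z \<and> z \<le> \<rho> ^ n * (h 1 / c)"
    if n: "0 < n" for n
  proof -
    obtain m where m: "n = Suc m" using n by (cases n) auto
    let ?H = "\<integral>\<^sup>+w. ennreal (rate w powr \<tau> * h (last w)) * indicator (words Sys UNIV n) w \<partial>count_space UNIV"
    have H: "?H = ennreal (\<rho> ^ n * h 1)"
      unfolding m by (rule weighted_partition_sum) (use h_pos \<open>0 < \<rho>\<close> eigen in auto)
    have le: "ennreal c * partition_sum \<tau> n \<le> ?H"
      unfolding partition_sum_def
      by (subst nn_integral_cmult[symmetric], simp, rule nn_integral_mono)
         (use h \<open>0 < c\<close> in \<open>auto simp: indicator_def mult.commute[of _ "rate _ powr _"] intro!: mult_left_mono ennreal_leI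
            simp flip: ennreal_mult'\<close>)
    have ge: "?H \<le> ennreal C * partition_sum \<tau> n"
      unfolding partition_sum_def
      by (subst nn_integral_cmult[symmetric], simp, rule nn_integral_mono)
         (use h C in \<open>auto simp: indicator_def mult.commute[of _ "rate _ powr _"] intro!: mult_left_mono ennreal_leI
            simp flip: ennreal_mult'\<close>)
    have "ennreal c * partition_sum \<tau> n < Orderings.top"
      using le by (simp add: H order_le_less_trans)
    then have "partition_sum \<tau> n \<noteq> Orderings.top"
      using \<open>0 < c\<close> by (auto simp: ennreal_mult_top)
    then obtain z where z: "0 \<le> z" "partition_sum \<tau> n = ennreal z"
      by (cases "partition_sum \<tau> n") auto
    have "c * z \<le> \<rho> ^ n * h 1"
      using le \<open>0 < c\<close> \<open>0 < \<rho>\<close> h_pos[of 1] z by (simp add: H flip: ennreal_mult')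
    moreover have "\<rho> ^ n * h 1 \<le> C * z"
      using ge C z by (simp add: H flip: ennreal_mult')
    ultimately show ?thesis
      using z C \<open>0 < c\<close> by (intro exI[of _ z]) (simp add: field_simps)
  qed
  define z where "z n = enn2real (partition_sum \<tau> n)" for n
  have z: "partition_sum \<tau> n = ennreal (z n)" "\<rho> ^ n * (h 1 / C) \<le> z n" "z n \<le> \<rho> ^ n * (h 1 / c)"
    and z_pos: "0 < z n" if n: "0 < n" for n
  proof -
    obtain x where x: "partition_sum \<tau> n = ennreal x" "\<rho> ^ n * (h 1 / C) \<le> x" "x \<le> \<rho> ^ n * (h 1 / c)"
      using bounds[OF n] by blast
    have "0 < \<rho> ^ n * (h 1 / C)" using \<open>0 < \<rho>\<close> C h_pos[of 1] by simp
    then have "0 < x" using x by linarith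
    then show "partition_sum \<tau> n = ennreal (z n)" "\<rho> ^ n * (h 1 / C) \<le> z n"
        "z n \<le> \<rho> ^ n * (h 1 / c)" "0 < z n"
      using x by (simp_all add: z_def)
  qed
  have ln_bounds: "ln \<rho> + ln (h 1 / C) / n \<le> ln (z n) / n" "ln (z n) / n \<le> ln \<rho> + ln (h 1 / c) / n"
    if n: "0 < n" for n
  proof -
    have ln_eq: "ln (\<rho> ^ n * (h 1 / d)) = n * ln \<rho> + ln (h 1 / d)" if "0 < d" for d
      using \<open>0 < \<rho>\<close> h_pos[of 1] that by (subst ln_mult_pos) (auto simp: ln_realpow)
    have "n * ln \<rho> + ln (h 1 / C) \<le> ln (z n)"
      unfolding ln_eq[OF C, symmetric] using z(2)[OF n] z_pos[OF n] \<open>0 < \<rho>\<close> C h_pos[of 1]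
      by (intro ln_mono) auto
    moreover have "ln (z n) \<le> n * ln \<rho> + ln (h 1 / c)"
      unfolding ln_eq[OF \<open>0 < c\<close>, symmetric] using z(3)[OF n] z_pos[OF n] by (intro ln_mono) auto
    ultimately have "(n * ln \<rho> + ln (h 1 / C)) / n \<le> ln (z n) / n"
        "ln (z n) / n \<le> (n * ln \<rho> + ln (h 1 / c)) / n"
      by (auto intro!: divide_right_mono)
    then show "ln \<rho> + ln (h 1 / C) / n \<le> ln (z n) / n" "ln (z n) / n \<le> ln \<rho> + ln (h 1 / c) / n"
      using n by (simp_all add: add_divide_distrib)
  qed
  have lim_const: "(\<lambda>n. ln \<rho> + x / real n) \<longlonglongrightarrow> ln \<rho>" for x
    using tendsto_add[OF tendsto_const lim_const_over_n[of x]] by simp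
  have "(\<lambda>n. ln (z n) / n) \<longlonglongrightarrow> ln \<rho>"
    by (rule tendsto_sandwich[OF _ _ lim_const[of "ln (h 1 / C)"] lim_const[of "ln (h 1 / c)"]])
       (use ln_bounds in \<open>auto simp: eventually_sequentially intro!: exI[of _ 1]\<close>)
  then have "(\<lambda>n. ereal (ln (z n) / n)) \<longlonglongrightarrow> ereal (ln \<rho>)"
    by simp
  moreover have "ereal (ln (z n) / n) = log_ennreal (partition_sum \<tau> n) / ereal (real n)" if "0 < n" for n
    using z(1)[OF that] z_pos[OF that] that by (simp add: log_ennreal_def)
  then have "\<forall>\<^sub>F n in sequentially. ereal (ln (z n) / n) = log_ennreal (partition_sum \<tau> n) / ereal (real n)"
    by (rule eventually_mono[OF eventually_gt_at_top[of 0]])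
  ultimately have "(\<lambda>n. log_ennreal (partition_sum \<tau> n) / ereal (real n)) \<longlonglongrightarrow> ereal (ln \<rho>)"
    by (rule Lim_transform_eventually)
  then show ?thesis
    unfolding pressure_eq_lim by (rule limI)
qed

text \<open>For each \<open>n > 0\<close>, the words made of one rung followed by zeros already have
  infinite total weight.\<close>

lemma pressure_infinite:
  assumes "(\<Sum>k. ennreal (r (k + 2) powr \<tau>)) = \<infinity>"
  shows "pressure Sys \<tau> = \<infinity>"
proof -
  have "partition_sum \<tau> n = \<infinity>" if n: "0 < n" for n
  proof -
    define c where "c = ennreal (rate (replicate (n - 1) 0) powr \<tau>)"
    let ?g = "\<lambda>k. (k + 2) # replicate (n - 1) 0"
    have words: "range ?g \<subseteq> words Sys UNIV n"
      using n by (auto simp: words_def successively_Cons successively_conv_nth inc_Sys nth_Cons hd_replicate split: nat.split)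
    have le_words: "(\<integral>\<^sup>+w. f w \<partial>count_space A) \<le>
        (\<integral>\<^sup>+w. f w * indicator (words Sys UNIV n) w \<partial>count_space UNIV)"
      if "A \<subseteq> words Sys UNIV n" for A and f :: "nat list \<Rightarrow> ennreal"
    proof -
      have "(\<integral>\<^sup>+w. f w \<partial>count_space A) = (\<integral>\<^sup>+w. f w * indicator A w \<partial>count_space UNIV)"
        by (simp add: nn_integral_count_space_indicator)
      also have "\<dots> \<le> (\<integral>\<^sup>+w. f w * indicator (words Sys UNIV n) w \<partial>count_space UNIV)"
        using that by (intro nn_integral_mono) (auto simp: indicator_def)
      finally show ?thesis .
    qed
    have "\<infinity> = c * (\<Sum>k. ennreal (r (k + 2) powr \<tau>))"
      unfolding assms c_def using rate_pos[of "replicate (n - 1) 0"] by (simp add: ennreal_mult_top)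
    also have "\<dots> = (\<integral>\<^sup>+k. ennreal (rate (?g k) powr \<tau>) \<partial>count_space UNIV)"
      unfolding nn_integral_count_space_nat ennreal_suminf_cmult[symmetric]
      using ratio_pos rate_pos by (intro suminf_cong) (simp add: c_def powr_mult less_imp_le mult.commute ennreal_mult')
    also have "\<dots> = (\<integral>\<^sup>+w. ennreal (rate w powr \<tau>) \<partial>count_space (range ?g))"
      by (rule nn_integral_bij_count_space) (auto intro!: inj_on_imp_bij_betw injI)
    also have "\<dots> \<le> partition_sum \<tau> n"
      unfolding partition_sum_def by (rule le_words[OF words])
    finally show ?thesis by (simp add: top_unique infinity_ennreal_def)
  qed
  then have "(\<infinity>::ereal) = log_ennreal (partition_sum \<tau> n) / ereal (real n)" if "0 < n" for n
    using that by (simp add: log_ennreal_def)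
  then have "\<forall>\<^sub>F n in sequentially. (\<infinity>::ereal) = log_ennreal (partition_sum \<tau> n) / ereal (real n)"
    by (rule eventually_mono[OF eventually_gt_at_top[of 0]])
  then have "(\<lambda>n. log_ennreal (partition_sum \<tau> n) / ereal (real n)) \<longlonglongrightarrow> \<infinity>"
    by (rule Lim_transform_eventually[OF tendsto_const])
  then show ?thesis
    unfolding pressure_eq_lim by (rule limI)
qed

end


section \<open>The star and the rail\<close>

text \<open>The weight of the letters \<open>0\<close> and \<open>1\<close> at the exponent
  \<open>1/4\<close>.\<close>

definition special_weight :: real
  where "special_weight = (1/4) powr (1/4)"

text \<open>The total weight of all rungs of the star at the exponent \<open>1/4\<close>. The factor
  \<open>289/512\<close> solves the eigenvalue equation at letter \<open>1\<close>.\<close>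

definition rung_weight :: real
  where "rung_weight = 289/512 * special_weight"

text \<open>Fourth powers, so that at the exponent \<open>1/4\<close> the weights of the rungs form
  a geometric series.\<close>

definition geometric_ratio :: "nat \<Rightarrow> real"
  where "geometric_ratio k = (if k \<le> 1 then 1/4 else (rung_weight / 2 ^ (k - 1)) ^ 4)"

text \<open>The largest rung ratios that \<open>ladder\<close> admits. At the exponent
  \<open>1/2\<close> they give a multiple of the harmonic series.\<close>

definition quadratic_ratio :: "nat \<Rightarrow> real"
  where "quadratic_ratio k = (if k \<le> 1 then 1/4 else 1 / (16 * (real k - 1)\<^sup>2))"

lemma special_weight_pos: "0 < special_weight"
  by (simp add: special_weight_def)

lemma rung_weight_bounds: "0 < rung_weight" "rung_weight \<le> 1"
proof -
  have "special_weight \<le> 1" by (simp add: special_weight_def powr_le1)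
  then show "0 < rung_weight" "rung_weight \<le> 1"
    using special_weight_pos by (auto simp: rung_weight_def)
qed

interpretation star: ladder geometric_ratio "\<lambda>_ _. False"
proof
  fix k :: nat assume "2 \<le> k"
  then obtain i where k: "k = i + 2" by (metis le_add_diff_inverse2)
  show "0 < geometric_ratio k"
    using rung_weight_bounds \<open>2 \<le> k\<close> by (simp add: geometric_ratio_def)
  \<comment> \<open>This yields \<open>2 ^ (k - 1) \<ge> 2 * (k - 1)\<close>, and the fourth power
    then supplies the factor \<open>1/16\<close>.\<close>
  have "real (Suc i) \<le> 2 ^ i"
    using less_exp[of i] by (metis Suc_leI of_nat_le_iff of_nat_numeral of_nat_power)
  then have "2 * real (Suc i) \<le> 2 ^ Suc i" by simp
  then have "rung_weight / 2 ^ Suc i \<le> 1 / (2 * real (Suc i))"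
    using rung_weight_bounds by (intro frac_le) auto
  then have "(rung_weight / 2 ^ Suc i) ^ 4 \<le> (1 / (2 * real (Suc i))) ^ 4"
    using rung_weight_bounds by (intro power_mono) auto
  also have "\<dots> = 1 / (16 * real (Suc i) ^ 4)"
    by (simp add: power_divide power_mult_distrib del: of_nat_Suc)
  also have "\<dots> \<le> 1 / (16 * (real (Suc i))\<^sup>2)"
    by (intro divide_left_mono mult_left_mono power_increasing) auto
  finally show "geometric_ratio k \<le> 1 / (16 * (real k - 1)\<^sup>2)"
    by (simp add: geometric_ratio_def k)
qed (auto simp: geometric_ratio_def)

interpretation rail: ladder quadratic_ratio "\<lambda>a b. a = Suc b \<or> b = Suc a"
  by unfold_locales (auto simp: quadratic_ratio_def)

lemma geometric_ratio_powr:
  "geometric_ratio k powr (1/4) = (if k \<le> 1 then special_weight else rung_weight / 2 ^ (k - 1))"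
proof (cases "k \<le> 1")
  case False
  define x where "x = rung_weight / 2 ^ (k - 1)"
  have "0 < x" using rung_weight_bounds by (simp add: x_def)
  then have "(x ^ 4) powr (1/4) = x"
    using powr_powr[of x 4 "1/4"] by (simp add: powr_numeral)
  then show ?thesis using False by (simp add: geometric_ratio_def x_def)
qed (simp add: geometric_ratio_def special_weight_def)

text \<open>The weights are chosen such that the eigenvalue equations at \<open>0\<close>, at \<open>1\<close> and at the rungs
  have a solution in closed form.\<close>

lemma pressure_star: "pressure star.Sys (1/4) = ereal (ln (17/8 * special_weight))"
proof (rule star.pressure_eq_ln_eigenvalue)
  \<comment> \<open>With \<open>h 0 = 1\<close>, the equation at \<open>0\<close> makes the
    eigenvalue \<open>(1 + h 1) * special_weight\<close>, and the one at a rung makes its value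
    \<open>1 / (1 + h 1)\<close>. The choice \<open>h 1 = 9/8\<close> is the one matched by
    \<open>rung_weight\<close>.\<close>
  define h :: "nat \<Rightarrow> real" where "h a = (if a = 0 then 1 else if a = 1 then 9/8 else 8/17)" for a
  show "8/17 \<le> h a" "h a \<le> 9/8" for a by (auto simp: h_def)
  show "(0::real) < 8/17" by simp
  show "0 < 17/8 * special_weight" using special_weight_pos by simp
  fix a
  define f where "f b = (if inc star.Sys a b then geometric_ratio b powr (1/4) * h b else 0)" for b
  consider "a = 0" | "a = 1" | "2 \<le> a" using star.nat_special_cases[of a] by blast
  then have "f sums (17/8 * special_weight * h a)"
  proof cases
    case 1
    have "f sums (\<Sum>b\<in>{0, 1}. f b)"
      by (rule sums_finite) (auto simp: f_def star.inc_Sys 1)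
    also have "(\<Sum>b\<in>{0, 1}. f b) = 17/8 * special_weight * h a"
      by (simp add: f_def star.inc_Sys h_def geometric_ratio_powr 1)
    finally show ?thesis .
  next
    case 2
    have "(\<lambda>i. rung_weight * 8/17 * (1/2) ^ Suc i) sums (rung_weight * 8/17 * 1)"
      by (intro sums_mult power_half_series)
    also have "(\<lambda>i. rung_weight * 8/17 * (1/2) ^ Suc i) = (\<lambda>i. f (i + 2))"
      by (auto simp: f_def star.inc_Sys h_def geometric_ratio_powr 2 power_one_over)
    finally have "f sums (rung_weight * 8/17 * 1 + (\<Sum>i<2. f i))"
      by (simp only: sums_iff_shift)
    also have "rung_weight * 8/17 * 1 + (\<Sum>i<2. f i) = 17/8 * special_weight * h a"
      by (simp add: numeral_2_eq_2 f_def star.inc_Sys h_def geometric_ratio_powr 2 rung_weight_def)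
    finally show ?thesis .
  next
    case 3
    have "f sums (\<Sum>b\<in>{0}. f b)"
      using 3 by (intro sums_finite) (auto simp: f_def star.inc_Sys)
    also have "(\<Sum>b\<in>{0}. f b) = 17/8 * special_weight * h a"
      using 3 by (simp add: f_def star.inc_Sys h_def geometric_ratio_powr)
    finally show ?thesis .
  qed
  then show "(\<lambda>b. if inc star.Sys a b then geometric_ratio b powr (1/4) * h b else 0)
      sums (17/8 * special_weight * h a)"
    unfolding f_def .
qed

section \<open>Bounds on the parameters of the two systems\<close>

lemma theta_star_le: "theta star.Sys \<le> ereal (1/4)"
  unfolding theta_def by (rule INF_lower) (simp add: pressure_star)

lemma theta1_star_le: "theta1 star.Sys \<le> ereal (1/3)"
  unfolding theta1_def by (rule order_trans[OF INF_lower[where f = "limit_dim star.Sys", OF star.rungs_cofinite] star.limit_dim_rungs_le])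

lemma theta2_star_ge: "ereal (1/2) \<le> theta2 star.Sys"
  unfolding theta2_def
  by (rule INF_greatest) (auto intro!: star.limit_dim_ge_half dest: star.irreducible_special[rotated])

lemma theta2_rail_le: "theta2 rail.Sys \<le> ereal (1/3)"
  unfolding theta2_def
  by (rule order_trans[OF INF_lower[where f = "limit_dim rail.Sys"] rail.limit_dim_rungs_le])
     (auto intro: rail.rungs_cofinite rail.rungs_irreducible)

lemma theta1_rail_le: "theta1 rail.Sys \<le> ereal (1/3)"
  unfolding theta1_def by (rule order_trans[OF INF_lower[where f = "limit_dim rail.Sys", OF rail.rungs_cofinite] rail.limit_dim_rungs_le])

lemma theta3_rail_ge: "ereal (1/2) \<le> theta3 rail.Sys"
  unfolding theta3_def
  by (rule INF_greatest) (use rail.limit_dim_ge_half rail.finitely_irreducible_special in blast)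

text \<open>The ratios are below \<open>1\<close>, so for \<open>\<tau> < 1/2\<close> the weights
  dominate those at the exponent \<open>1/2\<close>, and the harmonic series diverges.\<close>

lemma pressure_rail:
  assumes "\<tau> < 1/2"
  shows "pressure rail.Sys \<tau> = \<infinity>"
proof (rule rail.pressure_infinite, rule ccontr)
  assume "(\<Sum>k. ennreal (quadratic_ratio (k + 2) powr \<tau>)) \<noteq> \<infinity>"
  then have summable: "summable (\<lambda>k. quadratic_ratio (k + 2) powr \<tau>)"
    by (intro summable_suminf_not_top) auto
  have "summable (\<lambda>k. 1 / (4 * real (Suc k)))"
  proof (rule summable_comparison_test'[OF summable, of 0])
    fix k
    have ratio: "quadratic_ratio (k + 2) = (1 / (4 * real (Suc k)))\<^sup>2"
      by (simp add: quadratic_ratio_def power_divide power_mult_distrib del: of_nat_Suc)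
    have "1 / (4 * real (Suc k)) = quadratic_ratio (k + 2) powr (1/2)"
      unfolding ratio by (simp add: powr_half_sqrt)
    also have "\<dots> \<le> quadratic_ratio (k + 2) powr \<tau>"
      using assms rail.ratio_pos[of "k + 2"] rail.ratio_le[of "k + 2"] by (intro powr_mono') auto
    finally show "norm (1 / (4 * real (Suc k))) \<le> quadratic_ratio (k + 2) powr \<tau>"
      by simp
  qed
  then have "summable (\<lambda>k. 4 * (1 / (4 * real (Suc k))))"
    by (rule summable_mult)
  then have "summable (\<lambda>k. inverse (real (Suc k)))"
    by (simp add: inverse_eq_divide del: of_nat_Suc)
  then show False
    using not_summable_harmonic[where 'a = real] summable_Suc_iff[of "\<lambda>k. inverse (real k)"] by simp
qed

lemma theta_rail_ge: "ereal (1/2) \<le> theta rail.Sys"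
  unfolding theta_def
proof (rule INF_greatest)
  fix \<tau> assume "\<tau> \<in> {\<tau>. 0 \<le> \<tau> \<and> pressure rail.Sys \<tau> < \<infinity>}"
  then show "ereal (1/2) \<le> ereal \<tau>"
    using pressure_rail[of \<tau>] by (cases "\<tau> < 1/2") auto
qed

theorem theorem3p15:
  shows "\<exists>S1 S2 S3 S4 S5 :: (nat, nat, finseq) gdms.
    (\<forall>T \<in> {S1, S2, S3, S4, S5}. conformal_gdms T \<and> finitely_irreducible_alphabet T (edges T)) \<and>
    theta1 S1 < theta2 S1 \<and>
    theta1 S2 < theta S2 \<and>
    theta S3 < theta2 S3 \<and>
    theta2 S4 < theta3 S4 \<and>
    theta2 S5 < theta S5"
proof (rule exI[of _ star.Sys], rule exI[of _ rail.Sys], rule exI[of _ star.Sys],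
    rule exI[of _ rail.Sys], rule exI[of _ rail.Sys], intro conjI)
  show "\<forall>T \<in> {star.Sys, rail.Sys, star.Sys, rail.Sys, rail.Sys}.
      conformal_gdms T \<and> finitely_irreducible_alphabet T (edges T)"
    using star.conformal_gdms_Sys rail.conformal_gdms_Sys
      star.finitely_irreducible_Sys rail.finitely_irreducible_Sys by blast
  \<comment> \<open>In all five inequalities the left side is at most \<open>1/3\<close> or
    \<open>1/4\<close> and the right side at least \<open>1/2\<close>.\<close>
  have less: "x < y" if "x \<le> ereal a" "ereal b \<le> y" "a < b" for x y a b
    using that by (metis ereal_less_eq(3) leD le_less_trans less_ereal.simps(1) less_le_trans)
  show "theta1 star.Sys < theta2 star.Sys"
    by (rule less[OF theta1_star_le theta2_star_ge]) simp
  show "theta1 rail.Sys < theta rail.Sys"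
    by (rule less[OF theta1_rail_le theta_rail_ge]) simp
  show "theta star.Sys < theta2 star.Sys"
    by (rule less[OF theta_star_le theta2_star_ge]) simp
  show "theta2 rail.Sys < theta3 rail.Sys"
    by (rule less[OF theta2_rail_le theta3_rail_ge]) simp
  show "theta2 rail.Sys < theta rail.Sys"
    by (rule less[OF theta2_rail_le theta_rail_ge]) simp
qed

end
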